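(* Let $u\in\mathbb{R}^d$, $\theta>0$, $h>0$ and $F_0\in\mathcal{E}_{u,\theta}$. Suppose that $F_1$ is a minimizer of the functional $$I(F)=\frac{W_2^2(F_0,F)}{\theta}+hS(F)$$ subject to the constraint that $F_1$ has the same mean and variance as $F_0$ (i.e. over $F\in\mathcal{E}_{u,\theta}$). Let $\psi$ be the convex function on $\mathbb{R}^d$ such that $\nabla\psi\#F_1=F_0$. Then $$\int_{\mathbb{R}^d}|\nabla\ln F_1|^2F_1(v)\,dv<\infty$$ and $$\nabla\psi(v)=v+h\theta\,\nabla_v\left(\ln\frac{F_1}{M_{F_1}}\right)+(u-v)\left[\frac{W_2^2(F_1,F_0)}{d\theta}\right].$$
   Context: $\mathcal{P}$ denotes the set of probability densities $F$ on $\mathbb{R}^d$ with $\int|v|^2F(v)\,dv<\infty$, and $$\mathcal{E}_{u,\theta}=\Big\{F\in\mathcal{P}:\ \tfrac1d\int_{\mathbb{R}^d}|v-u|^2F(v)\,dv=\theta,\ \int_{\mathbb{R}^d}vF(v)\,dv=u\Big\}.$$ $W_2^2(F_0,F_1)=\inf_\gamma\int\tfrac12|v-w|^2\,\gamma(dv,dw)$ over couplings $\gamma$ of $F_0(v)dv$, $F_1(w)dw$ (note the factor $\tfrac12$). The entropy is $S(F)=\int_{\mathbb{R}^d}F\ln F\,dv\in(-\infty,\infty]$. $T\#F$ is the push-forward of $F$ under $T$. For $F\in\mathcal{P}$, $M_F$ denotes the isotropic Gaussian density with the same mean and variance as $F$ (so for $F\in\mathcal{E}_{u,\theta}$, $M_F(v)=(2\pi\theta)^{-d/2}e^{-|v-u|^2/2\theta}$).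 Gradients of $F_1$ and $\ln F_1$ are in the weak sense, $\nabla\ln F_1=\nabla F_1/F_1$, and identities hold $F_1(v)\,dv$-almost everywhere. *)

theory Defs
  imports "HOL-Analysis.Analysis"
begin

text \<open>The space is \<open>real ^ 'd\<close> with \<open>d = CARD('d) \<ge> 1\<close>. Densities with respect to Lebesgue
  measure are represented by Borel functions that are nonnegative everywhere.\<close>

definition prob_densities :: "(real ^ 'd \<Rightarrow> real) set" where
  "prob_densities = {F. F \<in> borel_measurable borel \<and> (\<forall>v. 0 \<le> F v) \<and>
     integrable lborel F \<and> (LINT v|lborel. F v) = 1 \<and>
     integrable lborel (\<lambda>v. (norm v)\<^sup>2 * F v)}"

definition mean :: "(real ^ 'd \<Rightarrow> real) \<Rightarrow> real ^ 'd" where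
  "mean F = (LINT v|lborel. F v *\<^sub>R v)"

definition constraint_set :: "real ^ 'd \<Rightarrow> real \<Rightarrow> (real ^ 'd \<Rightarrow> real) set" where
  "constraint_set u \<theta> = {F \<in> prob_densities.
     (1 / real CARD('d)) * (LINT v|lborel. (norm (v - u))\<^sup>2 * F v) = \<theta> \<and> mean F = u}"

definition couplings ::
    "(real ^ 'd \<Rightarrow> real) \<Rightarrow> (real ^ 'd \<Rightarrow> real) \<Rightarrow> ((real ^ 'd) \<times> (real ^ 'd)) measure set" where
  "couplings F G = {\<gamma>. sets \<gamma> = sets borel \<and>
     distr \<gamma> borel fst = density lborel (\<lambda>v. ennreal (F v)) \<and>
     distr \<gamma> borel snd = density lborel (\<lambda>w. ennreal (G w))}"

text \<open>The squared Wasserstein distance with the cost \<open>|v - w|\<^sup>2 / 2\<close>. The infimum is finite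
  whenever both densities have finite second moments, so \<open>enn2real\<close> loses nothing there.\<close>

definition W2_sq :: "(real ^ 'd \<Rightarrow> real) \<Rightarrow> (real ^ 'd \<Rightarrow> real) \<Rightarrow> real" where
  "W2_sq F G = enn2real (INF \<gamma>\<in>couplings F G.
     \<integral>\<^sup>+ (v, w). ennreal (1 / 2 * (norm (v - w))\<^sup>2) \<partial>\<gamma>)"

text \<open>The integral of \<open>F ln F\<close> as positive part minus negative part. For densities with finite
  second moment the negative part is finite, so the value lies in \<open>(-\<infinity>, \<infinity>]\<close>. As \<open>ln 0 = 0\<close>,
  points where \<open>F\<close> vanishes contribute \<open>0\<close>.\<close>

definition entropy :: "(real ^ 'd \<Rightarrow> real) \<Rightarrow> ereal" where
  "entropy F = enn2ereal (\<integral>\<^sup>+ v. ennreal (F v * ln (F v)) \<partial>lborel) -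
               enn2ereal (\<integral>\<^sup>+ v. ennreal (- (F v * ln (F v))) \<partial>lborel)"

definition step_functional ::
    "real \<Rightarrow> real \<Rightarrow> (real ^ 'd \<Rightarrow> real) \<Rightarrow> (real ^ 'd \<Rightarrow> real) \<Rightarrow> ereal" where
  "step_functional \<theta> h F0 F = ereal (W2_sq F0 F / \<theta>) + ereal h * entropy F"

definition is_minimizer_on :: "('a \<Rightarrow> ereal) \<Rightarrow> 'a set \<Rightarrow> 'a \<Rightarrow> bool" where
  "is_minimizer_on J A x \<longleftrightarrow> x \<in> A \<and> (\<forall>y\<in>A. J x \<le> J y)"

definition variance_temp :: "(real ^ 'd \<Rightarrow> real) \<Rightarrow> real" where
  "variance_temp F = (1 / real CARD('d)) * (LINT v|lborel. (norm (v - mean F))\<^sup>2 * F v)"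

definition maxwellian :: "(real ^ 'd \<Rightarrow> real) \<Rightarrow> real ^ 'd \<Rightarrow> real" where
  "maxwellian F v = (2 * pi * variance_temp F) powr (- real CARD('d) / 2) *
     exp (- (norm (v - mean F))\<^sup>2 / (2 * variance_temp F))"

text \<open>The pointwise gradient, set to \<open>0\<close> at points of non-differentiability. A convex function is
  differentiable almost everywhere, so this convention is immaterial for it.\<close>

definition grad :: "(real ^ 'd \<Rightarrow> real) \<Rightarrow> real ^ 'd \<Rightarrow> real ^ 'd" where
  "grad f v = (if f differentiable (at v) then (THE D. GDERIV f v :> D) else 0)"

text \<open>\<open>T # F = G\<close>; the push-forward is only meaningful for measurable \<open>T\<close>.\<close>

definition push_forward_eq ::
    "(real ^ 'd \<Rightarrow> real ^ 'd) \<Rightarrow> (real ^ 'd \<Rightarrow> real) \<Rightarrow> (real ^ 'd \<Rightarrow> real) \<Rightarrow> bool" where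
  "push_forward_eq T F G \<longleftrightarrow> T \<in> borel_measurable borel \<and>
     distr (density lborel (\<lambda>v. ennreal (F v))) borel T = density lborel (\<lambda>v. ennreal (G v))"

definition locally_integrable :: "(real ^ 'd \<Rightarrow> 'b::{banach, second_countable_topology}) \<Rightarrow> bool"
  where "locally_integrable f \<longleftrightarrow> (\<forall>K. compact K \<longrightarrow> set_integrable lborel K f)"

text \<open>Weak gradient, tested against all compactly supported \<open>C\<^sup>1\<close> functions \<open>\<phi>\<close> (with
  gradient \<open>D\<close>). For locally integrable \<open>f\<close> and \<open>g\<close> this is equivalent to
  testing against smooth compactly supported functions, by mollification.\<close>

definition has_weak_gradient :: "(real ^ 'd \<Rightarrow> real) \<Rightarrow> (real ^ 'd \<Rightarrow> real ^ 'd) \<Rightarrow> bool" where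
  "has_weak_gradient f g \<longleftrightarrow> locally_integrable f \<and> locally_integrable g \<and>
     (\<forall>\<phi> D. (\<forall>x. GDERIV \<phi> x :> D x) \<and> continuous_on UNIV D \<and>
            compact (closure {x. \<phi> x \<noteq> 0}) \<longrightarrow>
        (LINT x|lborel. f x *\<^sub>R D x) = - (LINT x|lborel. \<phi> x *\<^sub>R g x))"

text \<open>\<open>l\<close> is (a version of) \<open>\<nabla> ln f = \<nabla> f / f\<close>, with \<open>\<nabla> f\<close> in the weak sense. Where
  \<open>f\<close> vanishes, \<open>l\<close> is \<open>0\<close> by the convention on division.\<close>

definition has_weak_log_gradient :: "(real ^ 'd \<Rightarrow> real) \<Rightarrow> (real ^ 'd \<Rightarrow> real ^ 'd) \<Rightarrow> bool" where
  "has_weak_log_gradient f l \<longleftrightarrow> (\<exists>g. has_weak_gradient f g \<and> l = (\<lambda>v. g v /\<^sub>R f v))"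

end

theory Submission
  imports Defs "HOL-Probability.Distributions"
begin

text \<open>Write \<open>T = \<nabla>\<psi>\<close>. Since \<open>\<psi>\<close> and its convex conjugate are dual potentials, the coupling induced by
  \<open>T\<close> is optimal, so \<open>W\<^sub>2\<^sup>2(F\<^sub>0, F\<^sub>1)\<close> is the transport cost of \<open>T\<close>. For a test function \<open>\<phi>\<close> and a basis
  vector \<open>e\<close>, push \<open>F\<^sub>1\<close> forward under the shear \<open>v \<mapsto> v + t (\<phi>(v) - c) e\<close>, where \<open>c\<close> is the mean of \<open>\<phi>\<close>,
  followed by the dilation about \<open>u\<close> that restores the variance. The entropy changes by the explicit
  amount \<open>-\<integral> F\<^sub>1 ln J\<close> (\<open>J\<close> the Jacobian), and the new transport cost is at most that of the
  (generally not optimal) coupling induced by \<open>T\<close> and the perturbed map. So minimality gives an inequality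
  between explicit functions of \<open>t\<close> that is an equality at \<open>t = 0\<close>; equating derivatives yields the weak form
  of the Euler-Lagrange equation, with the dilation contributing the Lagrange-multiplier term
  \<open>W\<^sub>2\<^sup>2 / (d \<theta>)\<close>.\<close>

section \<open>Change of variables for shears\<close>

text \<open>Shears along a basis vector replace flows of general vector fields because they act on
  each line parallel to \<open>e\<close> separately: the Jacobian is exactly
  \<open>1 + t * (D v \<bullet> e)\<close>, the change of variables is a one-dimensional
  substitution, and inverting the map for small \<open>t\<close> is a contraction argument. Letting
  \<open>e\<close> run through \<open>Basis\<close> still recovers every component of the weak
  gradient. The perturbation must stay inside the constraint set exactly, not just to first order,
  since minimality says nothing about other densities. Centring \<phi> keeps the mean; a dilation
  about \<open>u\<close> then changes the variance and leaves the mean alone. Two integrability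
  issues shape the rest. Subtracting entropies needs the entropy of the minimizer to be finite,
  which follows by comparison with an admissible density of finite entropy. And no regularity of
  \<open>F1\<close> is assumed: the Euler-Lagrange equation itself exhibits the weak gradient as
  \<open>F1\<close> times a combination of \<open>T v - u\<close> and \<open>v - u\<close>, both
  square integrable under \<open>F1\<close>, so finiteness of the Fisher information comes out of
  the equation.\<close>

lemma nn_integral_deriv_indicator_preimage:
  fixes g g' :: "real \<Rightarrow> real"
  assumes deriv: "\<And>y. (g has_real_derivative g' y) (at y)"
    and cont: "continuous_on UNIV g'"
    and low: "\<And>y. m \<le> g' y" "m > 0"
    and "l \<le> u"
  shows "(\<integral>\<^sup>+ y. ennreal (g' y) * indicator {l<..<u} (g y) \<partial>lborel) = ennreal (u - l)"
proof -
  \<comment> \<open>The uniform slope bound serves twice: it makes \<open>g\<close> strictly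
    increasing, and its at least linear growth makes \<open>g\<close> onto.\<close>
  have mvt: "m * (z - y) \<le> g z - g y" if "y \<le> z" for y z
  proof (cases "y = z")
    case False
    with that have "y < z" by simp
    then obtain x where "g z - g y = (z - y) * g' x"
      using MVT2[of y z g g'] deriv by blast
    then show ?thesis using low(1)[of x] that by (simp add: mult.commute mult_right_mono)
  qed simp
  have strict: "g y < g z \<longleftrightarrow> y < z" for y z
  proof (cases y z rule: linorder_cases)
    case less then show ?thesis using mvt[of y z] low(2)
      by (smt (verit) mult_pos_pos)
  next
    case greater then show ?thesis using mvt[of z y] low(2)
      by (smt (verit) mult_pos_pos)
  qed simp
  have gc: "continuous_on S g" for S
    using deriv by (meson DERIV_isCont continuous_at_imp_continuous_on)
  have surj: "\<exists>y. g y = z" for z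
  proof -
    \<comment> \<open>Chosen so that growth at slope \<open>m\<close> from 0 over a distance
      \<open>r\<close> covers the gap between \<open>g 0\<close> and \<open>z\<close>.\<close>
    define r where "r = \<bar>z - g 0\<bar> / m"
    have r: "r \<ge> 0" "m * r = \<bar>z - g 0\<bar>" using low(2) by (auto simp: r_def)
    have "g (-r) \<le> z" using mvt[of "-r" 0] r by auto
    moreover have "z \<le> g r" using mvt[of 0 r] r by auto
    ultimately show ?thesis using IVT'[of g "-r" z r] r gc by force
  qed
  obtain a b where ab: "g a = l" "g b = u" using surj by metis
  have "a \<le> b" using strict[of b a] ab \<open>l \<le> u\<close> by linarith
  have [measurable]: "g' \<in> borel_measurable borel"
    using cont by (simp add: borel_measurable_continuous_onI)
  have "(\<integral>\<^sup>+ y. ennreal (g' y) * indicator {l<..<u} (g y) \<partial>lborel)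
      = (\<integral>\<^sup>+ y. ennreal (g' y) * indicator {a..b} y \<partial>lborel)"
  proof (rule nn_integral_cong_AE)
    \<comment> \<open>The preimage is the open interval between \<open>a\<close> and
      \<open>b\<close>, while the fundamental theorem is applied on the closed one; the two
      endpoints form a null set.\<close>
    have eq: "indicator {l<..<u} (g y) = (indicator {a..b} y :: ennreal)" if "y \<noteq> a" "y \<noteq> b" for y
    proof -
      have "g y \<in> {l<..<u} \<longleftrightarrow> y \<in> {a..b}"
        unfolding ab[symmetric] using that by (auto simp: strict)
      then show ?thesis by (simp add: indicator_def)
    qed
    show "AE y in lborel. ennreal (g' y) * indicator {l<..<u} (g y) = ennreal (g' y) * indicator {a..b} y"
      using AE_lborel_singleton[of a] AE_lborel_singleton[of b]
      by eventually_elim (simp add: eq)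
  qed
  also have "\<dots> = ennreal (g b - g a)"
  proof (rule nn_integral_FTC_Icc)
    show "DERIV g x :> g' x" for x by (rule deriv)
    show "0 \<le> g' x" for x
      using low(1)[of x] low(2) by linarith
  qed (use \<open>a \<le> b\<close> in auto)
  finally show ?thesis using ab by simp
qed

text \<open>Reduces a statement about maps that move only the coordinate along \<open>e\<close> to a
  one-dimensional one: the remaining coordinates \<open>x\<close> parametrize the lines parallel to
  \<open>e\<close>, and \<open>y\<close> runs along such a line.\<close>

lemma nn_integral_lborel_coordinate:
  fixes f :: "'a::euclidean_space \<Rightarrow> ennreal"
  assumes e: "e \<in> Basis" and [measurable]: "f \<in> borel_measurable borel"
  shows "(\<integral>\<^sup>+ v. f v \<partial>lborel) = (\<integral>\<^sup>+ x. (\<integral>\<^sup>+ y. f ((\<Sum>b\<in>Basis - {e}. x b *\<^sub>R b) + y *\<^sub>R e) \<partial>lborel)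
           \<partial>(\<Pi>\<^sub>M b\<in>Basis - {e}. lborel))"
proof -
  interpret product_sigma_finite "\<lambda>b::'a. lborel :: real measure"
    by standard
  let ?B = "Basis :: 'a set"
  have ins: "insert e (?B - {e}) = ?B" using e by auto
  have "(\<integral>\<^sup>+ v. f v \<partial>lborel) = (\<integral>\<^sup>+ x. f (\<Sum>b\<in>Basis. x b *\<^sub>R b) \<partial>(\<Pi>\<^sub>M b\<in>?B. lborel))"
    by (subst lborel_def) (simp add: nn_integral_distr lborel_eq_real)
  also have "\<dots> = (\<integral>\<^sup>+ x. f (\<Sum>b\<in>Basis. x b *\<^sub>R b) \<partial>(\<Pi>\<^sub>M b\<in>insert e (?B - {e}). lborel))"
    by (simp only: ins)
  also have "\<dots> = (\<integral>\<^sup>+ x. (\<integral>\<^sup>+ y. f (\<Sum>b\<in>Basis. (x(e := y)) b *\<^sub>R b) \<partial>lborel) \<partial>(\<Pi>\<^sub>M b\<in>?B - {e}. lborel))"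
    by (rule product_nn_integral_insert) (auto simp: ins)
  finally have lhs: "(\<integral>\<^sup>+ v. f v \<partial>lborel) = (\<integral>\<^sup>+ x. (\<integral>\<^sup>+ y. f (\<Sum>b\<in>Basis. (x(e := y)) b *\<^sub>R b) \<partial>lborel) \<partial>(\<Pi>\<^sub>M b\<in>?B - {e}. lborel))"
    .
  have eq: "(\<Sum>b\<in>Basis. (x(e := y)) b *\<^sub>R b) = (\<Sum>b\<in>Basis - {e}. x b *\<^sub>R b) + y *\<^sub>R e" for x y
    by (subst sum.remove[OF _ e]) (auto intro!: sum.cong)
  show ?thesis using lhs by (simp only: eq)
qed

lemma emeasure_distr_density:
  assumes "f \<in> borel_measurable M" "S \<in> measurable M N" "A \<in> sets N"
  shows "emeasure (distr (density M f) N S) A = (\<integral>\<^sup>+ x. f x * indicator A (S x) \<partial>M)"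
proof -
  note [measurable] = assms
  have "emeasure (distr (density M f) N S) A = (\<integral>\<^sup>+ y. indicator A y \<partial>distr (density M f) N S)"
    by simp
  then show ?thesis by (simp add: nn_integral_distr nn_integral_density del: nn_integral_indicator)
qed

text \<open>Boxes determine Lebesgue measure, and the shear maps each line parallel to
  \<open>e\<close> into itself. On such a line it is a function of one variable with derivative
  \<open>1 + D x \<bullet> e\<close>, which stays above \<open>1 - c > 0\<close>, so the
  one-dimensional substitution applies line by line.\<close>

lemma distr_shear_lborel:
  fixes \<rho> :: "'a::euclidean_space \<Rightarrow> real" and D :: "'a \<Rightarrow> 'a"
  assumes e: "e \<in> Basis"
    and deriv: "\<And>x. GDERIV \<rho> x :> D x"
    and cont: "continuous_on UNIV D"
    and bound: "\<And>x. norm (D x) \<le> c" "c < 1"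
  shows "distr (density lborel (\<lambda>x. ennreal (1 + D x \<bullet> e))) borel (\<lambda>x. x + \<rho> x *\<^sub>R e) = lborel"
proof (rule lborel_eqI[symmetric])
  have [measurable]: "\<rho> \<in> borel_measurable borel" "D \<in> borel_measurable borel"
    using deriv cont unfolding gderiv_def
    by (auto intro!: borel_measurable_continuous_onI continuous_at_imp_continuous_on
        dest: has_derivative_continuous)
  fix l u :: 'a assume lu: "\<And>b. b \<in> Basis \<Longrightarrow> l \<bullet> b \<le> u \<bullet> b"
  define w where "w x = (\<Sum>b\<in>Basis - {e}. x b *\<^sub>R b)" for x :: "'a \<Rightarrow> real"
  have we: "w x \<bullet> e = 0" for x
    using e by (auto simp: w_def inner_sum_left inner_Basis intro!: sum.neutral)
  define B where "B x \<longleftrightarrow> (\<forall>b\<in>Basis - {e}. l \<bullet> b < w x \<bullet> b \<and> w x \<bullet> b < u \<bullet> b)" for x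
  have box: "w x + y *\<^sub>R e \<in> box l u \<longleftrightarrow> B x \<and> y \<in> {l \<bullet> e<..<u \<bullet> e}" for x y
  proof -
    have "w x + y *\<^sub>R e \<in> box l u \<longleftrightarrow> (\<forall>b\<in>insert e (Basis - {e}). l \<bullet> b < (w x + y *\<^sub>R e) \<bullet> b \<and> (w x + y *\<^sub>R e) \<bullet> b < u \<bullet> b)"
      using e by (simp add: mem_box insert_absorb)
    also have "\<dots> \<longleftrightarrow> B x \<and> y \<in> {l \<bullet> e<..<u \<bullet> e}"
      using e we by (auto simp: B_def inner_add_left inner_Basis)
    finally show ?thesis .
  qed
  have inner: "(\<integral>\<^sup>+ y. ennreal (1 + D (w x + y *\<^sub>R e) \<bullet> e) *
        indicator (box l u) (w x + y *\<^sub>R e + \<rho> (w x + y *\<^sub>R e) *\<^sub>R e) \<partial>lborel)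
      = (\<integral>\<^sup>+ y. indicator (box l u) (w x + y *\<^sub>R e) \<partial>lborel)" for x
  proof -
    let ?g = "\<lambda>y. y + \<rho> (w x + y *\<^sub>R e)" and ?g' = "\<lambda>y. 1 + D (w x + y *\<^sub>R e) \<bullet> e"
    have R: "w x + y *\<^sub>R e + \<rho> (w x + y *\<^sub>R e) *\<^sub>R e = w x + ?g y *\<^sub>R e" for y
      by (simp add: algebra_simps)
    have "(\<integral>\<^sup>+ y. ennreal (?g' y) * indicator {l \<bullet> e<..<u \<bullet> e} (?g y) \<partial>lborel) = ennreal (u \<bullet> e - l \<bullet> e)"
    proof (rule nn_integral_deriv_indicator_preimage)
      show "(?g has_real_derivative ?g' y) (at y)" for y
      proof -
        have "(\<rho> has_derivative (\<lambda>h. h \<bullet> D (w x + y *\<^sub>R e))) (at (w x + y *\<^sub>R e))"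
          using deriv by (simp add: gderiv_def)
        moreover have "((\<lambda>y. w x + y *\<^sub>R e) has_derivative (\<lambda>h. h *\<^sub>R e)) (at y)"
          by (auto intro!: derivative_eq_intros)
        ultimately have "((\<lambda>y. \<rho> (w x + y *\<^sub>R e)) has_derivative (\<lambda>h. (h *\<^sub>R e) \<bullet> D (w x + y *\<^sub>R e))) (at y)"
          using has_derivative_compose[of "\<lambda>y. w x + y *\<^sub>R e" "\<lambda>h. h *\<^sub>R e" y UNIV \<rho>
                "\<lambda>h. h \<bullet> D (w x + y *\<^sub>R e)"] by blast
        then have "((\<lambda>y. \<rho> (w x + y *\<^sub>R e)) has_real_derivative (D (w x + y *\<^sub>R e) \<bullet> e)) (at y)"
          by (simp add: has_field_derivative_def inner_commute mult_commute_abs)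
        then show ?thesis by (auto intro!: derivative_eq_intros)
      qed
      show "continuous_on UNIV ?g'"
        by (intro continuous_intros continuous_on_compose2[OF cont]) auto
      have "\<bar>D z \<bullet> e\<bar> \<le> c" for z
        using Cauchy_Schwarz_ineq2[of "D z" e] bound(1)[of z] e by simp
      then show "1 - c \<le> ?g' y" for y
        by (smt (verit, best))
      show "1 - c > 0" using bound by simp
    qed (use lu e in auto)
    moreover have "(\<integral>\<^sup>+ y. indicator {l \<bullet> e<..<u \<bullet> e} y \<partial>lborel) = ennreal (u \<bullet> e - l \<bullet> e)"
      using lu e by simp
    \<comment> \<open>The shear does not change the coordinates other than the one along
      \<open>e\<close>, so if these already miss the box, both integrands vanish.\<close>
    ultimately show ?thesis
      unfolding R by (cases "B x") (simp_all add: indicator_def box)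
  qed
  have "emeasure (distr (density lborel (\<lambda>x. ennreal (1 + D x \<bullet> e))) borel (\<lambda>x. x + \<rho> x *\<^sub>R e)) (box l u)
     = (\<integral>\<^sup>+ x. ennreal (1 + D x \<bullet> e) * indicator (box l u) (x + \<rho> x *\<^sub>R e) \<partial>lborel)"
    by (rule emeasure_distr_density) auto
  also have "\<dots> = (\<integral>\<^sup>+ x. indicator (box l u) x \<partial>lborel)"
    by (subst (1 2) nn_integral_lborel_coordinate[OF e]) (use inner in \<open>simp_all add: w_def\<close>)
  also have "\<dots> = (\<Prod>b\<in>Basis. (u - l) \<bullet> b)" using lu by simp
  finally show "emeasure (distr (density lborel (\<lambda>x. ennreal (1 + D x \<bullet> e))) borel (\<lambda>x. x + \<rho> x *\<^sub>R e)) (box l u)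
     = (\<Prod>b\<in>Basis. (u - l) \<bullet> b)" .
qed simp

section \<open>Densities, push-forwards and entropy\<close>

abbreviation dens :: "('a::euclidean_space \<Rightarrow> real) \<Rightarrow> 'a measure" where
  "dens F \<equiv> density lborel (\<lambda>v. ennreal (F v))"

lemma distr_scale_lborel:
  fixes t :: "'a::euclidean_space"
  assumes "c \<noteq> 0"
  shows "distr (density lborel (\<lambda>_. ennreal (\<bar>c\<bar> ^ DIM('a)))) borel (\<lambda>x. t + c *\<^sub>R x) = lborel"
proof -
  have "distr (density lborel (\<lambda>_. ennreal (\<bar>c\<bar> ^ DIM('a)))) borel (\<lambda>x. t + c *\<^sub>R x)
      = density (distr lborel borel (\<lambda>x. t + c *\<^sub>R x)) (\<lambda>_. \<bar>c\<bar> ^ DIM('a))"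
    by (rule density_distr[symmetric]) auto
  then show ?thesis using lborel_affine[OF assms, of t] by simp
qed

text \<open>Stating the Jacobian as \<open>vol\<close>, that \<open>S\<close> carries
  \<open>dens J\<close> to Lebesgue measure, allows the change of variables without differentiating
  \<open>S\<close>: every integral is pulled back along \<open>S\<close>, where
  \<open>Q (S v)\<close> collapses to \<open>v\<close>.\<close>

lemma distr_dens_change_of_variables:
  fixes F J :: "'a::euclidean_space \<Rightarrow> real" and S Q :: "'a \<Rightarrow> 'a"
  assumes [measurable]: "F \<in> borel_measurable borel" "J \<in> borel_measurable borel"
      "S \<in> borel_measurable borel" "Q \<in> borel_measurable borel"
    and nonneg: "\<And>v. 0 \<le> F v" and pos: "\<And>v. 0 < J v"
    and vol: "distr (dens J) borel S = lborel" and inv: "\<And>v. Q (S v) = v"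
  shows "distr (dens F) borel S = dens (\<lambda>w. F (Q w) / J (Q w))"
proof (rule measure_eqI)
  fix A assume "A \<in> sets (distr (dens F) borel S)"
  then have [measurable]: "A \<in> sets borel" by simp
  have "emeasure (dens (\<lambda>w. F (Q w) / J (Q w))) A
      = (\<integral>\<^sup>+ w. ennreal (F (Q w) / J (Q w)) * indicator A w \<partial>distr (dens J) borel S)"
    unfolding vol by (simp add: emeasure_density)
  also have "\<dots> = (\<integral>\<^sup>+ v. ennreal (J v) * (ennreal (F v / J v) * indicator A (S v)) \<partial>lborel)"
    by (simp add: nn_integral_distr nn_integral_density inv)
  also have "\<dots> = (\<integral>\<^sup>+ v. ennreal (F v) * indicator A (S v) \<partial>lborel)"
  proof (rule nn_integral_cong)
    fix v
    show "ennreal (J v) * (ennreal (F v / J v) * indicator A (S v)) = ennreal (F v) * indicator A (S v)"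
      using pos[of v] nonneg[of v] by (simp add: mult.assoc[symmetric] ennreal_mult''[symmetric])
  qed
  also have "\<dots> = emeasure (distr (dens F) borel S) A"
    by (rule emeasure_distr_density[symmetric]) auto
  finally show "emeasure (distr (dens F) borel S) A = emeasure (dens (\<lambda>w. F (Q w) / J (Q w))) A" by simp
qed simp

section \<open>Moments and constraints under push-forward\<close>

lemma prob_densitiesD:
  assumes "F \<in> prob_densities"
  shows "F \<in> borel_measurable borel" "0 \<le> F v" "prob_space (dens F)"
    "integrable (dens F) (\<lambda>v. (norm v)\<^sup>2)"
proof -
  show F[measurable]: "F \<in> borel_measurable borel" and nn: "0 \<le> F v" for v
    using assms by (auto simp: prob_densities_def)
  have "(\<integral>\<^sup>+ v. ennreal (F v) \<partial>lborel) = ennreal (LINT v|lborel. F v)"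
    using assms by (intro nn_integral_eq_integral) (auto simp: prob_densities_def)
  then show "prob_space (dens F)"
    using assms by (intro prob_spaceI) (simp add: emeasure_density prob_densities_def)
  show "integrable (dens F) (\<lambda>v. (norm v)\<^sup>2)"
    using assms by (subst integrable_density) (auto simp: prob_densities_def mult.commute)
qed

lemma prob_densities_pushforward:
  assumes [measurable]: "G \<in> borel_measurable borel" "S \<in> borel_measurable borel"
    and nn: "\<And>v. 0 \<le> G v"
    and P: "prob_space (dens F)" and distr: "distr (dens F) borel S = dens G"
    and S2: "integrable (dens F) (\<lambda>v. (norm (S v))\<^sup>2)"
  shows "G \<in> prob_densities"
proof -
  have "prob_space (dens G)"
    unfolding distr[symmetric] by (rule prob_space.prob_space_distr[OF P]) simp
  then have "(\<integral>\<^sup>+ v. ennreal (G v) \<partial>lborel) = 1"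
    using prob_space.emeasure_space_1[of "dens G"] by (simp add: emeasure_density)
  then have "has_bochner_integral lborel G 1"
    using nn by (intro has_bochner_integral_nn_integral) auto
  moreover have "integrable (dens G) (\<lambda>v. (norm v)\<^sup>2)"
    unfolding distr[symmetric] using S2 by (simp add: integrable_distr_eq)
  then have "integrable lborel (\<lambda>v. (norm v)\<^sup>2 * G v)"
    using nn by (subst (asm) integrable_density) (auto simp: mult.commute)
  ultimately show ?thesis
    using nn by (auto simp: prob_densities_def has_bochner_integral_iff)
qed

text \<open>Phrases the constraints as moments under the measure \<open>dens F\<close>, the form in
  which they transform under push-forward.\<close>

lemma constraint_set_iff:
  fixes F :: "real ^ 'd \<Rightarrow> real"
  shows "F \<in> constraint_set u \<theta> \<longleftrightarrow> F \<in> prob_densities \<and>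
    (LINT v|dens F. v) = u \<and> (LINT v|dens F. (norm (v - u))\<^sup>2) = real CARD('d) * \<theta>"
proof (cases "F \<in> prob_densities")
  case True
  note [measurable] = prob_densitiesD(1)[OF True]
  have "(LINT v|dens F. v) = mean F"
    using prob_densitiesD(2)[OF True] by (simp add: integral_density mean_def)
  moreover have "(LINT v|dens F. (norm (v - u))\<^sup>2) = (LINT v|lborel. (norm (v - u))\<^sup>2 * F v)"
    using prob_densitiesD(2)[OF True] by (simp add: integral_density mult.commute)
  ultimately show ?thesis
    using True by (auto simp: constraint_set_def field_simps)
qed (simp add: constraint_set_def)

lemma constraint_set_pushforward:
  fixes F G :: "real ^ 'd \<Rightarrow> real"
  assumes [measurable]: "G \<in> borel_measurable borel" "S \<in> borel_measurable borel"
    and nn: "\<And>v. 0 \<le> G v"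
    and P: "prob_space (dens F)" and distr: "distr (dens F) borel S = dens G"
    and S2: "integrable (dens F) (\<lambda>v. (norm (S v))\<^sup>2)"
  shows "G \<in> constraint_set u \<theta> \<longleftrightarrow> (LINT v|dens F. S v) = u
    \<and> (LINT v|dens F. (norm (S v - u))\<^sup>2) = real CARD('d) * \<theta>"
proof -
  have "G \<in> prob_densities"
    by (rule prob_densities_pushforward[OF _ _ nn P distr S2]) measurable
  then show ?thesis
    by (simp add: constraint_set_iff distr[symmetric] integral_distr)
qed

section \<open>Finiteness of the entropy and its integral form\<close>

lemma entropy_eq_integral:
  assumes nn: "\<And>v. 0 \<le> F v" and [measurable]: "F \<in> borel_measurable borel"
    and int: "integrable (dens F) (\<lambda>v. ln (F v))"
  shows "entropy F = ereal (LINT v|dens F. ln (F v))"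
proof -
  have i: "integrable lborel (\<lambda>v. F v * ln (F v))"
    using int nn by (subst (asm) integrable_density) auto
  have fin: "(\<integral>\<^sup>+ v. ennreal (F v * ln (F v)) \<partial>lborel) < \<infinity>" "(\<integral>\<^sup>+ v. ennreal (- (F v * ln (F v))) \<partial>lborel) < \<infinity>"
    using i unfolding real_integrable_def by (auto simp: less_top)
  have "(LINT v|dens F. ln (F v)) = (LINT v|lborel. F v * ln (F v))"
    using nn by (subst integral_density) auto
  also have "\<dots> = enn2real (\<integral>\<^sup>+ v. ennreal (F v * ln (F v)) \<partial>lborel) -
       enn2real (\<integral>\<^sup>+ v. ennreal (- (F v * ln (F v))) \<partial>lborel)"
    using i by (rule real_lebesgue_integral_def)
  finally show ?thesis
    using fin unfolding entropy_def
    by (cases "\<integral>\<^sup>+ v. ennreal (F v * ln (F v)) \<partial>lborel" rule: ennreal_cases;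
        cases "\<integral>\<^sup>+ v. ennreal (- (F v * ln (F v))) \<partial>lborel" rule: ennreal_cases) auto
qed

text \<open>Pointwise Gibbs inequality: \<open>ln x \<le> x - 1\<close> at \<open>x = q / s\<close>.
  It trades \<open>ln s\<close> for the logarithm of a reference density \<open>q\<close>.\<close>

lemma neg_mult_ln_le:
  fixes s q :: real
  assumes "0 \<le> s" "0 < q"
  shows "- (s * ln s) \<le> q + s * (- ln q)"
proof (cases "s = 0")
  case False
  with assms have s: "s > 0" by simp
  have "ln (q / s) \<le> q / s - 1" using s assms by (intro ln_le_minus_one) auto
  then have "s * (ln q - ln s) \<le> s * (q / s - 1)"
    using s assms by (intro mult_left_mono) (auto simp: ln_div)
  also have "\<dots> \<le> q" using s by (simp add: field_simps)
  finally show ?thesis by (simp add: algebra_simps)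
qed (use assms in simp)

text \<open>Comparison with the standard Gaussian \<open>q\<close>: since \<open>- ln q\<close> is a
  constant plus half the squared norm, the finite second moment of \<open>F\<close> makes the bound
  from \<open>neg_mult_ln_le\<close> integrable.\<close>

lemma entropy_negative_part_finite:
  fixes F :: "real ^ 'd \<Rightarrow> real"
  assumes F: "F \<in> prob_densities"
  shows "(\<integral>\<^sup>+ v. ennreal (- (F v * ln (F v))) \<partial>lborel) < \<infinity>"
proof -
  note [measurable] = prob_densitiesD(1)[OF F]
  note nn = prob_densitiesD(2)[OF F]
  define q where "q v = (\<Prod>b\<in>Basis. std_normal_density (v \<bullet> b))" for v :: "real ^ 'd"
  have [measurable]: "q \<in> borel_measurable borel" unfolding q_def by measurable
  have qpos: "q v > 0" for v
    unfolding q_def by (intro prod_pos) (auto intro!: normal_density_pos)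
  define c where "c = real DIM(real ^ 'd) * ln (sqrt (2 * pi))"
  have "ln (q v) = - c - (norm v)\<^sup>2 / 2" for v
  proof -
    have norm_sq: "(norm v)\<^sup>2 = (\<Sum>b\<in>Basis. (v \<bullet> b)\<^sup>2)"
      unfolding power2_norm_eq_inner by (subst euclidean_inner) (simp add: power2_eq_square)
    have "ln (q v) = (\<Sum>b\<in>Basis. ln (std_normal_density (v \<bullet> b)))"
      unfolding q_def using normal_density_pos[of 1 0] by (intro ln_prod) (auto simp: less_le)
    also have "\<dots> = (\<Sum>b\<in>Basis. - ln (sqrt (2 * pi)) - (v \<bullet> b)\<^sup>2 / 2)"
      by (intro sum.cong) (simp_all add: std_normal_density_def ln_mult ln_div)
    also have "\<dots> = - c - (norm v)\<^sup>2 / 2"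
      by (simp add: sum_subtractf c_def sum_divide_distrib sum_negf norm_sq)
    finally show ?thesis .
  qed
  note lnq = this
  have "(\<integral>\<^sup>+ v. ennreal (q v) \<partial>lborel) = (\<integral>\<^sup>+ v. (\<Prod>b\<in>Basis. ennreal (std_normal_density (v \<bullet> b))) \<partial>(lborel :: (real ^ 'd) measure))"
    unfolding q_def by (simp add: prod_ennreal)
  also have "\<dots> = (\<Prod>b\<in>(Basis :: (real ^ 'd) set). (\<integral>\<^sup>+ x. ennreal (std_normal_density x) \<partial>lborel))"
    by (rule nn_integral_lborel_prod) auto
  also have "\<dots> < \<infinity>"
    by (simp add: nn_integral_eq_integral ennreal_prod_eq_top less_top[symmetric])
  finally have "integrable lborel q"
    using qpos by (intro integrableI_nonneg) (auto intro: less_imp_le)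
  then have i: "integrable lborel (\<lambda>v. q v + (c * F v + (norm v)\<^sup>2 * F v / 2))"
    using F by (auto simp: prob_densities_def)
  have "(\<integral>\<^sup>+ v. ennreal (- (F v * ln (F v))) \<partial>lborel) \<le> (\<integral>\<^sup>+ v. ennreal (norm (q v + (c * F v + (norm v)\<^sup>2 * F v / 2))) \<partial>lborel)"
  proof (intro nn_integral_mono ennreal_leI)
    fix v
    have "- (F v * ln (F v)) \<le> q v + (c * F v + (norm v)\<^sup>2 * F v / 2)"
      using neg_mult_ln_le[OF nn qpos, of v v] unfolding lnq by (simp add: algebra_simps)
    then show "- (F v * ln (F v)) \<le> norm (q v + (c * F v + (norm v)\<^sup>2 * F v / 2))" by simp
  qed
  also have "\<dots> < \<infinity>" using i by (simp add: integrable_iff_bounded)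
  finally show ?thesis .
qed

text \<open>The second moment already controls the negative part, so only the positive part could
  spoil integrability, and that would make the entropy infinite.\<close>

lemma entropy_finite_imp_integrable:
  fixes F :: "real ^ 'd \<Rightarrow> real"
  assumes F: "F \<in> prob_densities" and fin: "entropy F < \<infinity>"
  shows "integrable (dens F) (\<lambda>v. ln (F v))"
proof -
  note [measurable] = prob_densitiesD(1)[OF F]
  have "(\<integral>\<^sup>+ v. ennreal (F v * ln (F v)) \<partial>lborel) < \<infinity>"
    using fin entropy_negative_part_finite[OF F] unfolding entropy_def
    by (cases "\<integral>\<^sup>+ v. ennreal (F v * ln (F v)) \<partial>lborel" rule: ennreal_cases;
        cases "\<integral>\<^sup>+ v. ennreal (- (F v * ln (F v))) \<partial>lborel" rule: ennreal_cases) auto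
  then have "integrable lborel (\<lambda>v. F v * ln (F v))"
    using entropy_negative_part_finite[OF F] unfolding real_integrable_def by (auto simp: less_top)
  then show ?thesis
    using prob_densitiesD(2)[OF F] by (subst integrable_density) auto
qed

text \<open>The witness is the uniform density on the unit ball, dilated to the right variance and
  moved to the mean \<open>u\<close>. It guarantees that a minimizer is compared with at least one
  finite value.\<close>

lemma exists_finite_entropy_in_constraint_set:
  fixes u :: "real ^ 'd"
  assumes "\<theta> > 0"
  shows "\<exists>G \<in> constraint_set u \<theta>. entropy G < \<infinity>"
proof -
  define c where "c = measure lborel (ball 0 1 :: (real ^ 'd) set)"
  have c: "c > 0" unfolding c_def by (rule content_ball_pos) simp
  define F :: "real ^ 'd \<Rightarrow> real" where "F v = indicator (ball 0 1) v / c" for v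
  have [measurable]: "ball 0 1 \<in> sets (borel :: (real ^ 'd) measure)" by simp
  have [measurable]: "F \<in> borel_measurable borel" unfolding F_def by measurable
  have nn: "0 \<le> F v" for v using c by (simp add: F_def)
  have ball_ind: "has_bochner_integral lborel (indicator (ball 0 1) :: real ^ 'd \<Rightarrow> real) (measure lborel (ball 0 1 :: (real ^ 'd) set))"
    using emeasure_lborel_ball_finite[of "0 :: real ^ 'd" 1] by (intro has_bochner_integral_real_indicator) auto
  then have F1: "has_bochner_integral lborel F 1"
    using has_bochner_integral_divide_zero[OF ball_ind, of c] c unfolding F_def c_def by simp
  have P: "prob_space (dens F)"
  proof (rule prob_spaceI)
    show "emeasure (dens F) (space (dens F)) = 1"
      using F1 nn by (simp add: emeasure_density has_bochner_integral_iff nn_integral_eq_integral)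
  qed
  interpret prob_space "dens F" by (rule P)
  have ball: "AE v in dens F. norm v \<le> 1"
    by (subst AE_density) (auto simp: F_def indicator_def)
  \<comment> \<open>Reflection preserves volume (\<open>J\<close> is 1) and the ball, so the mean
    equals its own negative.\<close>
  have sym: "distr (dens F) borel uminus = dens F"
  proof -
    have "distr (dens F) borel uminus = dens (\<lambda>w. F (- w) / 1)"
      using distr_scale_lborel[of "-1" "0 :: real ^ 'd"] nn
      by (intro distr_dens_change_of_variables[where J = "\<lambda>_. 1"]) auto
    also have "(\<lambda>w. F (- w) / 1) = F" by (auto simp: F_def indicator_def)
    finally show ?thesis .
  qed
  have "(LINT v|dens F. v) = (LINT v|distr (dens F) borel uminus. v)" by (simp add: sym)
  also have "\<dots> = (LINT v|dens F. - v)" by (simp add: integral_distr)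
  finally have mean0: "(LINT v|dens F. v) = 0" by (simp add: eq_neg_iff_add_eq_0 scaleR_2[symmetric])
  define V where "V = (LINT v|dens F. (norm v)\<^sup>2)"
  have i2: "integrable (dens F) (\<lambda>v. (norm v)\<^sup>2)"
    by (rule integrable_const_bound[where B = 1]) (use ball in \<open>auto elim!: eventually_mono intro: power_le_one\<close>)
  \<comment> \<open>Zero variance would concentrate the measure at the origin, but a measure with a
    density charges no point.\<close>
  have "V \<noteq> 0"
  proof
    assume "V = 0"
    then have "AE v in dens F. (norm v)\<^sup>2 = 0"
      using integral_nonneg_eq_0_iff_AE[OF i2] by (simp add: V_def)
    then have "AE v in dens F. v = 0" by simp
    moreover have "AE v in dens F. v \<noteq> 0"
      by (subst AE_density) (use AE_lborel_singleton[of "0 :: real ^ 'd"] in \<open>auto elim: eventually_mono\<close>)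
    ultimately have "AE v in dens F. False" by eventually_elim simp
    then show False by simp
  qed
  then have V: "V > 0" unfolding V_def by (simp add: less_le)
  \<comment> \<open>Dilation by \<open>r\<close> multiplies the variance by the square of
    \<open>r\<close>, which fixes its value.\<close>
  define r where "r = sqrt (real CARD('d) * \<theta> / V)"
  have r: "r > 0" "r\<^sup>2 * V = real CARD('d) * \<theta>"
    using assms V by (auto simp: r_def)
  define S where "S v = u + r *\<^sub>R v" for v
  define Q where "Q w = (1 / r) *\<^sub>R (w - u)" for w
  define J where "J = (\<lambda>_ :: real ^ 'd. r ^ CARD('d))"
  define G where "G w = F (Q w) / J (Q w)" for w
  have [measurable]: "S \<in> borel_measurable borel" "Q \<in> borel_measurable borel" "J \<in> borel_measurable borel" "G \<in> borel_measurable borel"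
    unfolding S_def Q_def J_def G_def by measurable
  have vol: "distr (dens J) borel S = lborel"
    using distr_scale_lborel[of r u] r unfolding J_def S_def by simp
  have distr: "distr (dens F) borel S = dens G"
    unfolding G_def by (rule distr_dens_change_of_variables[OF _ _ _ _ nn _ vol]) (use r in \<open>auto simp: J_def S_def Q_def\<close>)
  have nnG: "0 \<le> G w" for w using nn r by (simp add: G_def J_def)
  have iS: "integrable (dens F) (\<lambda>v. (norm (S v))\<^sup>2)"
  proof (rule integrable_const_bound[where B = "(norm u + r)\<^sup>2"])
    show "AE v in dens F. norm ((norm (S v))\<^sup>2) \<le> (norm u + r)\<^sup>2"
      using ball
    proof eventually_elim
      case (elim v)
      then have "norm (S v) \<le> norm u + r"
        unfolding S_def using r by (intro norm_triangle_le add_mono) auto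
      then show "norm ((norm (S v))\<^sup>2) \<le> (norm u + r)\<^sup>2" by (simp add: power_mono)
    qed
  qed simp
  have iv: "integrable (dens F) (\<lambda>v. v)"
    by (rule integrable_const_bound[where B = 1]) (use ball in auto)
  have "(LINT v|dens F. S v) = u"
    unfolding S_def using iv mean0 prob_space by simp
  moreover have "(LINT v|dens F. (norm (S v - u))\<^sup>2) = real CARD('d) * \<theta>"
    using r by (simp add: S_def power_mult_distrib V_def)
  ultimately have G: "G \<in> constraint_set u \<theta>"
    by (subst constraint_set_pushforward[OF _ _ nnG P distr iS]) auto
  \<comment> \<open>The only nonzero value of \<open>G\<close>. Excluding the value \<infinity>
    requires a bound on the positive part alone.\<close>
  define K where "K = 1 / (c * r ^ CARD('d))"
  have "(\<integral>\<^sup>+ v. ennreal (G v * ln (G v)) \<partial>lborel) \<le> (\<integral>\<^sup>+ v. ennreal (norm (\<bar>ln K\<bar> * G v)) \<partial>lborel)"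
  proof (intro nn_integral_mono ennreal_leI)
    fix v
    have "G v = 0 \<or> G v = K" by (auto simp: G_def F_def J_def K_def indicator_def)
    then have "G v * ln (G v) = ln K * G v" by auto
    also have "\<dots> \<le> \<bar>ln K\<bar> * G v" using nnG by (intro mult_right_mono) auto
    finally show "G v * ln (G v) \<le> norm (\<bar>ln K\<bar> * G v)" by simp
  qed
  also have "\<dots> < \<infinity>"
  proof -
    have "integrable lborel G" using G by (simp add: constraint_set_def prob_densities_def)
    then have "integrable lborel (\<lambda>v. \<bar>ln K\<bar> * G v)" by simp
    then show ?thesis unfolding integrable_iff_bounded by simp
  qed
  finally have "Defs.entropy G < \<infinity>"
    unfolding Defs.entropy_def
    by (cases "\<integral>\<^sup>+ v. ennreal (G v * ln (G v)) \<partial>lborel" rule: ennreal_cases;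
        cases "\<integral>\<^sup>+ v. ennreal (- (G v * ln (G v))) \<partial>lborel" rule: ennreal_cases) auto
  with G show ?thesis by blast
qed

section \<open>Gradients of a convex function\<close>

lemma grad_subgradient:
  fixes \<psi> :: "real ^ 'd \<Rightarrow> real"
  assumes convex: "convex_on UNIV \<psi>" and diff: "\<psi> differentiable (at v)"
  shows "\<psi> v + grad \<psi> v \<bullet> (w - v) \<le> \<psi> w"
proof -
  obtain f' where f': "(\<psi> has_derivative f') (at v)" using diff by (auto simp: differentiable_def)
  interpret f': bounded_linear f' using f' by (rule has_derivative_bounded_linear)
  \<comment> \<open>The vector representing the linear functional \<open>f'\<close>; uniqueness of
    derivatives then identifies it with the description in \<open>grad\<close>.\<close>
  define D where "D = (\<Sum>b\<in>Basis. f' b *\<^sub>R b)"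
  have "f' = (\<lambda>h. h \<bullet> D)"
  proof
    fix h
    show "f' h = h \<bullet> D"
    by (subst euclidean_representation[of h, symmetric])
       (simp add: f'.sum f'.scaleR D_def inner_sum_right mult.commute)
  qed
  then have D: "GDERIV \<psi> v :> D" using f' by (simp add: gderiv_def)
  have "grad \<psi> v = D"
    unfolding grad_def using diff
  proof (simp, intro the_equality D)
    fix E assume "GDERIV \<psi> v :> E"
    then have "(\<lambda>h. h \<bullet> E) = (\<lambda>h. h \<bullet> D)"
      using D unfolding gderiv_def by (rule has_derivative_unique)
    then have "(E - D) \<bullet> E = (E - D) \<bullet> D" by meson
    then have "(E - D) \<bullet> (E - D) = 0" by (simp add: inner_diff_right)
    then show "E = D" by simp
  qed
  \<comment> \<open>On the line through \<open>v\<close> and \<open>w\<close> the claim becomes the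
    one-variable fact that a convex function lies above its tangent, here at 0 and evaluated at
    1.\<close>
  define f where "f s = \<psi> (v + s *\<^sub>R (w - v))" for s :: real
  have "convex_on UNIV f"
  proof (rule convex_onI)
    fix t x y :: real assume t: "0 < t" "t < 1"
    have "v + ((1 - t) *\<^sub>R x + t *\<^sub>R y) *\<^sub>R (w - v) = (1 - t) *\<^sub>R (v + x *\<^sub>R (w - v)) + t *\<^sub>R (v + y *\<^sub>R (w - v))"
      by (simp add: algebra_simps)
    then show "f ((1 - t) *\<^sub>R x + t *\<^sub>R y) \<le> (1 - t) * f x + t * f y"
      using convex_onD[OF convex, of t] t unfolding f_def by simp
  qed simp
  moreover have "(f has_field_derivative ((w - v) \<bullet> D)) (at 0)"
  proof -
    have "((\<lambda>s. v + s *\<^sub>R (w - v)) has_derivative (\<lambda>s. s *\<^sub>R (w - v))) (at (0::real))"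
      by (auto intro!: derivative_eq_intros)
    moreover have "(\<psi> has_derivative (\<lambda>h. h \<bullet> D)) (at (v + 0 *\<^sub>R (w - v)))"
      using D by (simp add: gderiv_def)
    ultimately have "((\<lambda>s. \<psi> (v + s *\<^sub>R (w - v))) has_derivative (\<lambda>s. (s *\<^sub>R (w - v)) \<bullet> D)) (at 0)"
      by (rule has_derivative_compose)
    then show ?thesis by (simp add: f_def[abs_def] has_field_derivative_def mult_commute_abs)
  qed
  ultimately have "f 1 - f 0 \<ge> ((w - v) \<bullet> D) * (1 - 0)"
    by (intro convex_on_imp_above_tangent[where A = UNIV]) auto
  then show ?thesis by (simp add: f_def \<open>grad \<psi> v = D\<close> inner_commute)
qed

text \<open>A density charges no point, so the value \<open>0\<close> that \<open>grad\<close> takes off the set of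
  differentiability is attained with probability \<open>0\<close>.\<close>

lemma AE_differentiable_of_push_forward:
  assumes "push_forward_eq (grad \<psi>) F G" and [measurable]: "G \<in> borel_measurable borel"
  shows "AE v in dens F. \<psi> differentiable (at v)"
proof -
  have [measurable]: "grad \<psi> \<in> borel_measurable borel" and distr: "distr (dens F) borel (grad \<psi>) = dens G"
    using assms by (auto simp: push_forward_eq_def)
  have "AE x in lborel. 0 < ennreal (G x) \<longrightarrow> x \<noteq> 0"
    using AE_lborel_singleton[of 0] by eventually_elim simp
  then have "AE x in distr (dens F) borel (grad \<psi>). x \<noteq> 0"
    unfolding distr by (subst AE_density) auto
  then have "AE v in dens F. grad \<psi> v \<noteq> 0" by (subst (asm) AE_distr_iff) auto
  then show ?thesis by eventually_elim (auto simp: grad_def split: if_splits)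
qed

section \<open>Optimality of the gradient map\<close>

lemma (in finite_measure) integrable_of_norm_square:
  fixes f :: "'a \<Rightarrow> 'b::{banach, second_countable_topology}"
  assumes "f \<in> borel_measurable M" "integrable M (\<lambda>x. (norm (f x))\<^sup>2)"
  shows "integrable M f"
proof (rule integrable_norm_cancel)
  show "integrable M (\<lambda>x. norm (f x))"
    by (rule square_integrable_imp_integrable) (use assms in simp_all)
qed fact

lemma integrable_inner_of_norm_square:
  fixes f g :: "'a \<Rightarrow> 'b::{real_inner, second_countable_topology}"
  assumes [measurable]: "f \<in> borel_measurable M" "g \<in> borel_measurable M"
    and "integrable M (\<lambda>x. (norm (f x))\<^sup>2)" "integrable M (\<lambda>x. (norm (g x))\<^sup>2)"
  shows "integrable M (\<lambda>x. f x \<bullet> g x)"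
proof (rule Bochner_Integration.integrable_bound)
  show "integrable M (\<lambda>x. (norm (f x))\<^sup>2 + (norm (g x))\<^sup>2)" using assms by simp
  show "AE x in M. norm (f x \<bullet> g x) \<le> norm ((norm (f x))\<^sup>2 + (norm (g x))\<^sup>2)"
  proof (rule AE_I2)
    fix x
    have "\<bar>f x \<bullet> g x\<bar> \<le> norm (f x) * norm (g x)" by (rule Cauchy_Schwarz_ineq2)
    also have "\<dots> \<le> (norm (f x))\<^sup>2 + (norm (g x))\<^sup>2"
      using sum_squares_bound[of "norm (f x)" "norm (g x)"] mult_nonneg_nonneg[OF norm_ge_zero norm_ge_zero, of "f x" "g x"]
      by linarith
    finally show "norm (f x \<bullet> g x) \<le> norm ((norm (f x))\<^sup>2 + (norm (g x))\<^sup>2)" by simp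
  qed
qed simp

lemma integrable_between:
  fixes f g h :: "'a \<Rightarrow> real"
  assumes "integrable M f" "integrable M h" "g \<in> borel_measurable M"
    and "AE x in M. f x \<le> g x" "AE x in M. g x \<le> h x"
  shows "integrable M g"
proof (rule Bochner_Integration.integrable_bound)
  show "integrable M (\<lambda>x. \<bar>f x\<bar> + \<bar>h x\<bar>)" using assms by simp
  show "AE x in M. norm (g x) \<le> norm (\<bar>f x\<bar> + \<bar>h x\<bar>)" using assms(4,5) by eventually_elim auto
qed fact

text \<open>The right-hand side sees only the positive part of \<open>f\<close>. This matters in the
  duality argument, where the sum of potentials that bounds the cost from below may be
  negative.\<close>

lemma integral_le_nn_integral:
  fixes f :: "'a \<Rightarrow> real"
  assumes "integrable M f"
  shows "ennreal (integral\<^sup>L M f) \<le> (\<integral>\<^sup>+ x. ennreal (f x) \<partial>M)"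
proof -
  have "ennreal (integral\<^sup>L M f) \<le> ennreal (LINT x|M. max 0 (f x))"
    using assms by (intro ennreal_leI integral_mono) auto
  also have "\<dots> = (\<integral>\<^sup>+ x. ennreal (max 0 (f x)) \<partial>M)"
    using assms by (intro nn_integral_eq_integral[symmetric]) auto
  also have "\<dots> = (\<integral>\<^sup>+ x. ennreal (f x) \<partial>M)"
    by (intro nn_integral_cong) (simp add: max_def ennreal_neg)
  finally show ?thesis .
qed

section \<open>Couplings and the transport cost\<close>

lemma borel_measurable_quadratic_cost [measurable]:
  "(\<lambda>(v, w). ennreal (1 / 2 * (norm (v - w))\<^sup>2)) \<in> borel_measurable (borel :: ((real ^ 'd) \<times> (real ^ 'd)) measure)"
proof -
  have "(\<lambda>p :: (real ^ 'd) \<times> (real ^ 'd). 1 / 2 * (norm (fst p - snd p))\<^sup>2) \<in> borel_measurable borel"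
    by (intro borel_measurable_continuous_onI continuous_intros)
  then show ?thesis by (simp add: case_prod_beta')
qed

lemma borel_measurable_fst_snd [measurable]:
  "fst \<in> borel_measurable (borel :: ('a::euclidean_space \<times> 'b::euclidean_space) measure)"
  "snd \<in> borel_measurable (borel :: ('a::euclidean_space \<times> 'b::euclidean_space) measure)"
  by (intro borel_measurable_continuous_onI continuous_intros)+

lemma borel_measurable_Pair_borel:
  fixes T :: "'c \<Rightarrow> 'a::euclidean_space" and S :: "'c \<Rightarrow> 'b::euclidean_space"
  assumes "T \<in> borel_measurable M" "S \<in> borel_measurable M"
  shows "(\<lambda>v. (T v, S v)) \<in> borel_measurable M"
  using measurable_Pair[OF assms] by (simp add: borel_prod)

lemma W2_sq_commute: "W2_sq F G = W2_sq G F"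
proof -
  have le: "(INF \<gamma>\<in>couplings G F. \<integral>\<^sup>+ (v, w). ennreal (1 / 2 * (norm (v - w))\<^sup>2) \<partial>\<gamma>)
       \<le> (INF \<gamma>\<in>couplings F G. \<integral>\<^sup>+ (v, w). ennreal (1 / 2 * (norm (v - w))\<^sup>2) \<partial>\<gamma>)"
    for F G :: "real ^ 'd \<Rightarrow> real"
  proof (rule INF_mono)
    fix \<gamma> assume \<gamma>: "\<gamma> \<in> couplings F G"
    have s: "sets \<gamma> = sets borel" using \<gamma> by (simp add: couplings_def)
    note [measurable_cong] = s
    define swap where "swap = (\<lambda>p :: (real ^ 'd) \<times> (real ^ 'd). (snd p, fst p))"
    have [measurable]: "swap \<in> borel_measurable borel"
      unfolding swap_def by (rule borel_measurable_Pair_borel) measurable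
    have "distr (distr \<gamma> borel swap) borel fst = distr \<gamma> borel snd"
      by (subst distr_distr) (auto simp: swap_def comp_def)
    moreover have "distr (distr \<gamma> borel swap) borel snd = distr \<gamma> borel fst"
      by (subst distr_distr) (auto simp: swap_def comp_def)
    ultimately have "distr \<gamma> borel swap \<in> couplings G F"
      using \<gamma> by (simp add: couplings_def)
    moreover have "(\<integral>\<^sup>+ (v, w). ennreal (1 / 2 * (norm (v - w))\<^sup>2) \<partial>distr \<gamma> borel swap)
        = (\<integral>\<^sup>+ (v, w). ennreal (1 / 2 * (norm (v - w))\<^sup>2) \<partial>\<gamma>)"
      by (subst nn_integral_distr) (auto simp: swap_def case_prod_beta' norm_minus_commute)
    ultimately show "\<exists>\<gamma>'\<in>couplings G F. (\<integral>\<^sup>+ (v, w). ennreal (1 / 2 * (norm (v - w))\<^sup>2) \<partial>\<gamma>')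
        \<le> (\<integral>\<^sup>+ (v, w). ennreal (1 / 2 * (norm (v - w))\<^sup>2) \<partial>\<gamma>)"
      by (metis order_refl)
  qed
  show ?thesis unfolding W2_sq_def using le[of F G] le[of G F] by (simp add: antisym)
qed

text \<open>Two images of one measure are coupled through their common source. The bound is kept in
  \<open>ennreal\<close>, before \<open>enn2real\<close>, because the duality proof determines the
  infimum itself.\<close>

lemma INF_cost_le_pushforward:
  assumes "T \<in> borel_measurable borel" "S \<in> borel_measurable borel"
    and "distr (dens F) borel T = dens F0" "distr (dens F) borel S = dens G"
    and int: "integrable (dens F) (\<lambda>v. (norm (T v - S v))\<^sup>2)"
  shows "(INF \<gamma>\<in>couplings F0 G. \<integral>\<^sup>+ (v, w). ennreal (1 / 2 * (norm (v - w))\<^sup>2) \<partial>\<gamma>)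
    \<le> ennreal (1 / 2 * (LINT v|dens F. (norm (T v - S v))\<^sup>2))"
proof (rule INF_lower2)
  note [measurable] = assms(1,2)
  have [measurable]: "(\<lambda>v. (T v, S v)) \<in> borel_measurable borel"
    by (rule borel_measurable_Pair_borel) measurable
  let ?\<gamma> = "distr (dens F) borel (\<lambda>v. (T v, S v))"
  show "?\<gamma> \<in> couplings F0 G"
    using assms by (simp add: couplings_def distr_distr comp_def)
  have "(\<integral>\<^sup>+ (v, w). ennreal (1 / 2 * (norm (v - w))\<^sup>2) \<partial>?\<gamma>) = (\<integral>\<^sup>+ v. ennreal (1 / 2 * (norm (T v - S v))\<^sup>2) \<partial>dens F)"
    by (subst nn_integral_distr) auto
  also have "\<dots> = ennreal (LINT v|dens F. 1 / 2 * (norm (T v - S v))\<^sup>2)"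
    using int by (intro nn_integral_eq_integral) auto
  finally show "(\<integral>\<^sup>+ (v, w). ennreal (1 / 2 * (norm (v - w))\<^sup>2) \<partial>?\<gamma>) \<le> ennreal (1 / 2 * (LINT v|dens F. (norm (T v - S v))\<^sup>2))"
    by simp
qed

lemma W2_sq_le_pushforward:
  assumes "T \<in> borel_measurable borel" "S \<in> borel_measurable borel"
    and "distr (dens F) borel T = dens F0" "distr (dens F) borel S = dens G"
    and "integrable (dens F) (\<lambda>v. (norm (T v - S v))\<^sup>2)"
  shows "W2_sq F0 G \<le> 1 / 2 * (LINT v|dens F. (norm (T v - S v))\<^sup>2)"
  unfolding W2_sq_def
  by (rule order.trans[OF enn2real_mono[OF INF_cost_le_pushforward[OF assms]]]) simp_all

text \<open>Kantorovich duality with the potential \<open>\<psi>\<close> and its conjugate: the inequality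
  \<open>x \<bullet> v \<le> \<psi> v + p x\<close> integrates to a lower bound on the cost of every coupling, and it is an
  equality on the graph of \<open>T\<close>.\<close>

lemma W2_sq_eq_subgradient_map:
  fixes F F0 \<psi> :: "real ^ 'd \<Rightarrow> real"
  assumes F: "F \<in> prob_densities" and F0: "F0 \<in> prob_densities"
    and T[measurable]: "T \<in> borel_measurable borel" and distr: "distr (dens F) borel T = dens F0"
    and cont: "continuous_on UNIV \<psi>"
    and sub: "AE v in dens F. \<forall>w. \<psi> v + T v \<bullet> (w - v) \<le> \<psi> w"
  shows "W2_sq F0 F = 1 / 2 * (LINT v|dens F. (norm (T v - v))\<^sup>2)"
proof -
  interpret prob_space "dens F" by (rule prob_densitiesD(3)[OF F])
  have [measurable]: "\<psi> \<in> borel_measurable borel" using cont by (rule borel_measurable_continuous_onI)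
  obtain D :: "(real ^ 'd) set" where D: "countable D" "\<And>X. open X \<Longrightarrow> X \<noteq> {} \<Longrightarrow> \<exists>d\<in>D. d \<in> X"
    using countable_dense_setE by blast
  \<comment> \<open>The convex conjugate of \<psi>. Restricting the supremum to a countable dense
    set makes it Borel measurable; continuity of \<psi> recovers the inequality at all points in
    \<open>upper\<close>.\<close>
  define P where "P x = (SUP v\<in>D. ereal (x \<bullet> v - \<psi> v))" for x
  have [measurable]: "P \<in> borel_measurable borel"
    unfolding P_def using D(1) by measurable
  \<comment> \<open>\<open>real_of_ereal\<close> sends \<infinity> to 0, so \<open>p\<close> agrees
    with the conjugate only where \<open>P\<close> is finite; hence the hypothesis of
    \<open>young\<close>, which \<open>Pfin\<close> supplies almost everywhere.\<close>
  define p where "p x = real_of_ereal (P x)" for x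
  have [measurable]: "p \<in> borel_measurable borel" unfolding p_def by measurable
  have upper: "x \<bullet> v - \<psi> v \<le> c" if "P x \<le> ereal c" for x v c
  proof (rule ccontr)
    assume "\<not> ?thesis"
    then have ne: "v \<in> {v. c < x \<bullet> v - \<psi> v}" unfolding mem_Collect_eq not_le .
    have "open {v. c < x \<bullet> v - \<psi> v}"
      using cont by (intro open_Collect_less continuous_intros)
    then obtain d where "d \<in> D" "c < x \<bullet> d - \<psi> d" using D(2)[of "{v. c < x \<bullet> v - \<psi> v}"] ne by blast
    moreover have "ereal (x \<bullet> d - \<psi> d) \<le> P x" unfolding P_def by (rule SUP_upper) (rule \<open>d \<in> D\<close>)
    ultimately show False using that by (metis ereal_less_eq(3) leD order.trans)
  qed
  have "D \<noteq> {}" using D(2)[of UNIV] by auto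
  have notm: "P x \<noteq> - \<infinity>" for x
    using \<open>D \<noteq> {}\<close> SUP_upper[of _ D "\<lambda>v. ereal (x \<bullet> v - \<psi> v)"] unfolding P_def by fastforce
  have young: "x \<bullet> v \<le> \<psi> v + p x" if "P x \<noteq> \<infinity>" for x v
  proof -
    have "P x \<le> ereal (p x)" using notm[of x] that by (cases "P x") (auto simp: p_def)
    then show ?thesis using upper[of x "p x" v] by simp
  qed
  \<comment> \<open>The subgradient inequality at \<open>v\<close> says precisely that no point
    beats \<open>v\<close> in the supremum defining the conjugate at \<open>T v\<close>.\<close>
  have PT: "AE v in dens F. P (T v) \<le> ereal (T v \<bullet> v - \<psi> v)"
    using sub
  proof eventually_elim
    case (elim v)
    then show ?case unfolding P_def by (intro SUP_least) (simp add: inner_diff_right algebra_simps)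
  qed
  have eqT: "AE v in dens F. p (T v) = T v \<bullet> v - \<psi> v"
    using PT
  proof eventually_elim
    case (elim v)
    then have "P (T v) \<noteq> \<infinity>" by auto
    then have "T v \<bullet> v \<le> \<psi> v + p (T v)" by (rule young)
    moreover have "p (T v) \<le> T v \<bullet> v - \<psi> v"
      using elim notm[of "T v"] by (cases "P (T v)") (auto simp: p_def)
    ultimately show ?case by simp
  qed
  have Pfin: "AE x in dens F0. P x \<noteq> \<infinity>"
    unfolding distr[symmetric] by (subst AE_distr_iff) (use PT in \<open>auto elim!: eventually_mono\<close>)

  have i2: "integrable (dens F) (\<lambda>v. (norm v)\<^sup>2)" by (rule prob_densitiesD(4)[OF F])
  have iT2: "integrable (dens F) (\<lambda>v. (norm (T v))\<^sup>2)"
    using prob_densitiesD(4)[OF F0] unfolding distr[symmetric] by (simp add: integrable_distr_eq)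
  have iTv: "integrable (dens F) (\<lambda>v. T v \<bullet> v)"
    by (rule integrable_inner_of_norm_square[OF _ _ iT2 i2]) simp_all
  \<comment> \<open>A property that holds almost surely under a probability measure holds somewhere.
    One such point provides an affine minorant of \<psi>.\<close>
  have "\<exists>v. \<forall>w. \<psi> v + T v \<bullet> (w - v) \<le> \<psi> w"
  proof (rule ccontr)
    assume no: "\<not> ?thesis"
    from sub have "AE v in dens F. False" by eventually_elim (use no in blast)
    then show False by simp
  qed
  then obtain v0 where v0: "\<And>w. \<psi> v0 + T v0 \<bullet> (w - v0) \<le> \<psi> w" by blast
  have iv: "integrable (dens F) (\<lambda>v. v)"
    by (rule integrable_of_norm_square[OF _ i2]) simp
  \<comment> \<open>The affine minorant at \<open>v0\<close> bounds \<psi> from below; the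
    subgradient inequality tested at \<open>w = 0\<close> bounds it from above by an integrable
    function.\<close>
  have i\<psi>: "integrable (dens F) \<psi>"
  proof (rule integrable_between[where f = "\<lambda>v. \<psi> v0 + T v0 \<bullet> (v - v0)" and h = "\<lambda>v. T v \<bullet> v + \<psi> 0"])
    show "integrable (dens F) (\<lambda>v. T v \<bullet> v + \<psi> 0)"
      by (intro Bochner_Integration.integrable_add iTv integrable_const)
    show "integrable (dens F) (\<lambda>v. \<psi> v0 + T v0 \<bullet> (v - v0))"
      by (intro Bochner_Integration.integrable_add integrable_inner_right Bochner_Integration.integrable_diff iv integrable_const)
    show "AE v in dens F. \<psi> v0 + T v0 \<bullet> (v - v0) \<le> \<psi> v" by (rule AE_I2) (rule v0)
    show "AE v in dens F. \<psi> v \<le> T v \<bullet> v + \<psi> 0"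
      using sub by eventually_elim (drule spec[of _ 0], simp)
  qed simp
  have ipT: "integrable (dens F) (\<lambda>v. p (T v))"
    using eqT iTv i\<psi> by (subst integrable_cong_AE[where g = "\<lambda>v. T v \<bullet> v - \<psi> v"]) auto
  have ip: "integrable (dens F0) p"
    unfolding distr[symmetric] using ipT by (simp add: integrable_distr_eq)
  have i02: "integrable (dens F0) (\<lambda>v. (norm v)\<^sup>2)" by (rule prob_densitiesD(4)[OF F0])

  \<comment> \<open>With \<open>g\<close>, the dual potentials for the quadratic cost: expanding the
    square turns Young's inequality into
    \<open>f x + g v \<le> 1 / 2 * (norm (x - v))\<^sup>2\<close>, with equality almost everywhere
    on the graph of \<open>T\<close>.\<close>
  define f where "f x = 1 / 2 * (norm x)\<^sup>2 - p x" for x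
  define g where "g v = 1 / 2 * (norm v)\<^sup>2 - \<psi> v" for v
  have [measurable]: "f \<in> borel_measurable borel" "g \<in> borel_measurable borel" unfolding f_def g_def by measurable
  have if': "integrable (dens F0) f" unfolding f_def using ip i02 by simp
  have ig: "integrable (dens F) g" unfolding g_def using i\<psi> i2 by simp
  have ifT: "integrable (dens F) (\<lambda>v. f (T v))"
    using if' unfolding distr[symmetric] by (simp add: integrable_distr_eq)
  have diff_sq: "1 / 2 * (norm (x - v))\<^sup>2 = 1 / 2 * (norm x)\<^sup>2 + 1 / 2 * (norm v)\<^sup>2 - x \<bullet> v" for x v :: "real ^ 'd"
    by (simp add: power2_norm_eq_inner inner_diff inner_commute algebra_simps)
  define C where "C = 1 / 2 * (LINT v|dens F. (norm (T v - v))\<^sup>2)"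
  have Ceq: "C = (LINT v|dens F. f (T v)) + (LINT v|dens F. g v)"
  proof -
    have "C = (LINT v|dens F. 1 / 2 * (norm (T v - v))\<^sup>2)" by (simp add: C_def)
    also have "\<dots> = (LINT v|dens F. f (T v) + g v)"
    proof (rule integral_cong_AE)
      show "AE v in dens F. 1 / 2 * (norm (T v - v))\<^sup>2 = f (T v) + g v"
        using eqT
      proof eventually_elim
        case (elim v)
        then show ?case unfolding diff_sq f_def g_def by linarith
      qed
    qed simp_all
    finally show ?thesis using ifT ig by simp
  qed
  have lower: "ennreal C \<le> (\<integral>\<^sup>+ (v, w). ennreal (1 / 2 * (norm (v - w))\<^sup>2) \<partial>\<gamma>)" if \<gamma>: "\<gamma> \<in> couplings F0 F" for \<gamma>
  proof -
    have s: "sets \<gamma> = sets borel" using \<gamma> by (simp add: couplings_def)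
    note [measurable_cong] = s
    have m1: "distr \<gamma> borel fst = dens F0" and m2: "distr \<gamma> borel snd = dens F"
      using \<gamma> by (auto simp: couplings_def)
    have i1: "integrable \<gamma> (\<lambda>p. f (fst p))" using if' unfolding m1[symmetric] by (simp add: integrable_distr_eq)
    have i2: "integrable \<gamma> (\<lambda>p. g (snd p))" using ig unfolding m2[symmetric] by (simp add: integrable_distr_eq)
    have "C = (LINT p|\<gamma>. f (fst p) + g (snd p))"
    proof -
      have "(LINT v|dens F. f (T v)) = (LINT x|dens F0. f x)"
        unfolding distr[symmetric] by (simp add: integral_distr)
      also have "\<dots> = (LINT p|\<gamma>. f (fst p))" unfolding m1[symmetric] by (simp add: integral_distr)
      finally have "(LINT v|dens F. f (T v)) = (LINT p|\<gamma>. f (fst p))" .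
      moreover have "(LINT v|dens F. g v) = (LINT p|\<gamma>. g (snd p))" unfolding m2[symmetric] by (simp add: integral_distr)
      ultimately show ?thesis using i1 i2 by (simp add: Ceq)
    qed
    also have "ennreal \<dots> \<le> (\<integral>\<^sup>+ p. ennreal (f (fst p) + g (snd p)) \<partial>\<gamma>)"
      using i1 i2 by (intro integral_le_nn_integral) auto
    also have "\<dots> \<le> (\<integral>\<^sup>+ (v, w). ennreal (1 / 2 * (norm (v - w))\<^sup>2) \<partial>\<gamma>)"
    proof (rule nn_integral_mono_AE)
      have "AE p in \<gamma>. P (fst p) \<noteq> \<infinity>"
        using Pfin unfolding m1[symmetric] by (subst (asm) AE_distr_iff) auto
      then show "AE p in \<gamma>. ennreal (f (fst p) + g (snd p)) \<le> (case p of (v, w) \<Rightarrow> ennreal (1 / 2 * (norm (v - w))\<^sup>2))"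
      proof eventually_elim
        case (elim p)
        then have "f (fst p) + g (snd p) \<le> 1 / 2 * (norm (fst p - snd p))\<^sup>2"
          using young[OF elim, of "snd p"] unfolding diff_sq f_def g_def by linarith
        then show ?case by (auto simp: case_prod_beta' intro: ennreal_leI)
      qed
    qed
    finally show ?thesis .
  qed
  have iC: "integrable (dens F) (\<lambda>v. (norm (T v - v))\<^sup>2)"
  proof -
    have "(norm (T v - v))\<^sup>2 = (norm (T v))\<^sup>2 + (norm v)\<^sup>2 - 2 * (T v \<bullet> v)" for v
      using diff_sq[of "T v" v] by simp
    then show ?thesis using iT2 i2 iTv by simp
  qed
  have "(INF \<gamma>\<in>couplings F0 F. \<integral>\<^sup>+ (v, w). ennreal (1 / 2 * (norm (v - w))\<^sup>2) \<partial>\<gamma>) = ennreal C"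
  proof (rule antisym)
    show "(INF \<gamma>\<in>couplings F0 F. \<integral>\<^sup>+ (v, w). ennreal (1 / 2 * (norm (v - w))\<^sup>2) \<partial>\<gamma>) \<le> ennreal C"
      unfolding C_def using INF_cost_le_pushforward[OF T _ distr _ iC] by (simp add: distr_id2)
  qed (use lower in \<open>auto intro: INF_greatest\<close>)
  moreover have "C \<ge> 0" by (simp add: C_def)
  ultimately show ?thesis unfolding W2_sq_def C_def by simp
qed

section \<open>First variation at a minimizer\<close>

lemma lipschitz_of_gradient_bound:
  assumes "\<And>x. GDERIV \<rho> x :> D x" and "\<And>x. norm (D x) \<le> c"
  shows "\<bar>\<rho> x - \<rho> y\<bar> \<le> c * norm (x - y)"
proof -
  have "norm (\<rho> x - \<rho> y) \<le> c * norm (x - y)"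
  proof (rule differentiable_bound[where S = UNIV])
    show "(\<rho> has_derivative (\<lambda>h. h \<bullet> D x)) (at x within UNIV)" for x
      using assms(1) by (simp add: gderiv_def)
    show "onorm (\<lambda>h. h \<bullet> D x) \<le> c" for x
    proof (rule onorm_bound)
      show "0 \<le> c" using assms(2)[of x] norm_ge_zero[of "D x"] by linarith
      show "norm (h \<bullet> D x) \<le> c * norm h" for h
      proof -
        have "norm (h \<bullet> D x) \<le> norm h * norm (D x)" using Cauchy_Schwarz_ineq2[of h "D x"] by simp
        also have "\<dots> \<le> norm h * c" using assms(2) by (intro mult_left_mono) auto
        finally show ?thesis by (simp add: mult.commute)
      qed
    qed
  qed auto
  then show ?thesis by simp
qed

text \<open>Solving \<open>x + \<rho> x *\<^sub>R e = w\<close> means finding a fixed point of the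
  contraction \<open>\<lambda>x. w - \<rho> x *\<^sub>R e\<close>. The same estimate makes the
  inverse Lipschitz with constant \<open>1 / (1 - c)\<close>, hence Borel.\<close>

lemma shear_inverse:
  fixes \<rho> :: "'a::euclidean_space \<Rightarrow> real"
  assumes e: "norm e = 1" and lip: "\<And>x y. \<bar>\<rho> x - \<rho> y\<bar> \<le> c * norm (x - y)" and c: "0 \<le> c" "c < 1"
  obtains Q where "Q \<in> borel_measurable borel" "\<And>x. Q (x + \<rho> x *\<^sub>R e) = x"
proof -
  let ?R = "\<lambda>x. x + \<rho> x *\<^sub>R e"
  have "\<exists>!x. w - \<rho> x *\<^sub>R e = x" for w
  proof (rule banach_fix_type[OF c])
    have "dist (w - \<rho> x *\<^sub>R e) (w - \<rho> y *\<^sub>R e) \<le> c * dist x y" for x y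
    proof -
      have "dist (w - \<rho> x *\<^sub>R e) (w - \<rho> y *\<^sub>R e) = norm ((\<rho> y - \<rho> x) *\<^sub>R e)"
        by (simp add: dist_norm algebra_simps)
      also have "\<dots> \<le> c * norm (y - x)" using lip e by simp
      finally show ?thesis by (simp add: dist_norm norm_minus_commute)
    qed
    then show "\<forall>x y. dist (w - \<rho> x *\<^sub>R e) (w - \<rho> y *\<^sub>R e) \<le> c * dist x y" by blast
  qed
  moreover have "w - \<rho> x *\<^sub>R e = x \<longleftrightarrow> ?R x = w" for w x by (auto simp: algebra_simps)
  ultimately have ex1: "\<exists>!x. ?R x = w" for w by simp
  define Q where "Q w = (THE x. ?R x = w)" for w
  have RQ: "?R (Q w) = w" for w unfolding Q_def by (rule theI') (rule ex1)
  have QR: "Q (?R x) = x" for x unfolding Q_def using ex1[of "?R x"] by (intro the1_equality) auto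
  have Qlip: "dist (Q v) (Q w) \<le> 1 / (1 - c) * dist v w" for v w
  proof -
    have "norm (Q v - Q w) = norm ((v - w) - (\<rho> (Q v) - \<rho> (Q w)) *\<^sub>R e)"
      by (subst (3 4) RQ[symmetric]) (simp add: algebra_simps)
    also have "\<dots> \<le> norm (v - w) + norm ((\<rho> (Q v) - \<rho> (Q w)) *\<^sub>R e)" by (rule norm_triangle_ineq4)
    also have "\<dots> \<le> norm (v - w) + c * norm (Q v - Q w)" using lip e by simp
    finally have "(1 - c) * norm (Q v - Q w) \<le> norm (v - w)" by (simp add: algebra_simps)
    then show ?thesis using c by (simp add: dist_norm field_simps)
  qed
  have "continuous_on UNIV Q"
  proof (rule continuous_onI)
    fix w :: 'a and \<epsilon> :: real assume "\<epsilon> > 0"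
    show "\<exists>d>0. \<forall>v\<in>UNIV. dist v w < d \<longrightarrow> dist (Q v) (Q w) \<le> \<epsilon>"
    proof (intro exI[of _ "\<epsilon> * (1 - c)"] conjI ballI impI)
      show "0 < \<epsilon> * (1 - c)" using \<open>\<epsilon> > 0\<close> c by simp
      fix v assume "dist v w < \<epsilon> * (1 - c)"
      then have "1 / (1 - c) * dist v w \<le> \<epsilon>" using c by (simp add: field_simps)
      then show "dist (Q v) (Q w) \<le> \<epsilon>" using Qlip[of v w] by linarith
    qed
  qed
  then have "Q \<in> borel_measurable borel" by (rule borel_measurable_continuous_onI)
  then show ?thesis using that QR by blast
qed

text \<open>Shear followed by dilation about \<open>u\<close>: the two Jacobians multiply because
  the dilation has a constant one, which passes unchanged through the push-forward by the
  shear.\<close>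

lemma distr_scaled_shear_lborel:
  fixes \<rho> :: "'a::euclidean_space \<Rightarrow> real" and D :: "'a \<Rightarrow> 'a"
  assumes e: "e \<in> Basis" and deriv: "\<And>x. GDERIV \<rho> x :> D x" and cont: "continuous_on UNIV D"
    and bound: "\<And>x. norm (D x) \<le> c" "c < 1" and a: "a > 0"
  shows "distr (dens (\<lambda>x. a ^ DIM('a) * (1 + D x \<bullet> e))) borel (\<lambda>x. u + a *\<^sub>R (x + \<rho> x *\<^sub>R e - u)) = lborel"
proof -
  let ?R = "\<lambda>x. x + \<rho> x *\<^sub>R e" and ?A = "\<lambda>w. (u - a *\<^sub>R u) + a *\<^sub>R w"
  have [measurable]: "\<rho> \<in> borel_measurable borel" "D \<in> borel_measurable borel"
    using deriv cont unfolding gderiv_def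
    by (auto intro!: borel_measurable_continuous_onI continuous_at_imp_continuous_on
        dest: has_derivative_continuous)
  have "\<bar>D x \<bullet> e\<bar> \<le> c" for x
    using Cauchy_Schwarz_ineq2[of "D x" e] bound(1)[of x] e by simp
  then have pos: "1 + D x \<bullet> e > 0" for x
    using bound(2) by (smt (verit, best))
  have "dens (\<lambda>x. a ^ DIM('a) * (1 + D x \<bullet> e)) = density (dens (\<lambda>x. 1 + D x \<bullet> e)) (\<lambda>_. ennreal (a ^ DIM('a)))"
    using a pos by (subst density_density_eq) (auto simp: ennreal_mult[symmetric] less_imp_le mult.commute)
  then have "distr (dens (\<lambda>x. a ^ DIM('a) * (1 + D x \<bullet> e))) borel ?R
      = density (distr (dens (\<lambda>x. 1 + D x \<bullet> e)) borel ?R) (\<lambda>_. ennreal (a ^ DIM('a)))"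
    by (simp add: density_distr)
  also have "\<dots> = dens (\<lambda>_. a ^ DIM('a))"
    by (subst distr_shear_lborel[OF e deriv cont bound]) simp
  finally have "distr (distr (dens (\<lambda>x. a ^ DIM('a) * (1 + D x \<bullet> e))) borel ?R) borel ?A = lborel"
    using distr_scale_lborel[of a "u - a *\<^sub>R u"] a by simp
  then show ?thesis
    by (subst (asm) distr_distr) (auto simp: comp_def algebra_simps)
qed

section \<open>Comparing a minimizer with its push-forwards\<close>

lemma constraint_setD:
  fixes F :: "real ^ 'd \<Rightarrow> real"
  assumes "F \<in> constraint_set u \<theta>"
  shows "F \<in> prob_densities" "F \<in> borel_measurable borel" "0 \<le> F v" "prob_space (dens F)"
    "integrable (dens F) (\<lambda>v. (norm v)\<^sup>2)" "integrable (dens F) (\<lambda>v. v)" "(LINT v|dens F. v) = u"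
    "(LINT v|dens F. (norm (v - u))\<^sup>2) = real CARD('d) * \<theta>"
proof -
  show F: "F \<in> prob_densities" and "(LINT v|dens F. v) = u"
    "(LINT v|dens F. (norm (v - u))\<^sup>2) = real CARD('d) * \<theta>"
    using assms by (auto simp: constraint_set_iff)
  note Fp = prob_densitiesD[OF F]
  show "F \<in> borel_measurable borel" "0 \<le> F v" "prob_space (dens F)" by (rule Fp)+
  show i2: "integrable (dens F) (\<lambda>v. (norm v)\<^sup>2)" by (rule Fp)
  interpret prob_space "dens F" by (rule Fp)
  show "integrable (dens F) (\<lambda>v. v)" by (rule integrable_of_norm_square[OF _ i2]) simp
qed

lemma norm_diff_sq: "(norm (x - y))\<^sup>2 = (norm x)\<^sup>2 - 2 * (x \<bullet> y) + (norm y)\<^sup>2" for x y :: "'a::real_inner"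
  by (simp add: power2_norm_eq_inner inner_diff inner_commute)

lemma integrable_norm_diff_sq:
  fixes f g :: "'a \<Rightarrow> 'b::{real_inner, second_countable_topology}"
  assumes "f \<in> borel_measurable M" "g \<in> borel_measurable M"
    and "integrable M (\<lambda>x. (norm (f x))\<^sup>2)" "integrable M (\<lambda>x. (norm (g x))\<^sup>2)"
  shows "integrable M (\<lambda>x. (norm (f x - g x))\<^sup>2)"
  unfolding norm_diff_sq
  by (intro Bochner_Integration.integrable_add Bochner_Integration.integrable_diff integrable_mult_right
      integrable_inner_of_norm_square assms)

text \<open>Excludes the degenerate case in which the minimal value is \<infinity>. The transport
  term is a real number, so a finite value of the functional leaves a finite entropy.\<close>

lemma minimizer_entropy_integrable:
  fixes F :: "real ^ 'd \<Rightarrow> real"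
  assumes "\<theta> > 0" "h > 0" and min: "is_minimizer_on (step_functional \<theta> h F0) (constraint_set u \<theta>) F"
  shows "integrable (dens F) (\<lambda>v. ln (F v))"
proof (rule entropy_finite_imp_integrable)
  have F: "F \<in> constraint_set u \<theta>" using min by (simp add: is_minimizer_on_def)
  then show "F \<in> prob_densities" by (rule constraint_setD)
  obtain G where G: "G \<in> constraint_set u \<theta>" "entropy G < \<infinity>"
    using exists_finite_entropy_in_constraint_set[OF \<open>\<theta> > 0\<close>] by blast
  have "step_functional \<theta> h F0 F \<le> step_functional \<theta> h F0 G"
    using min G by (simp add: is_minimizer_on_def)
  also have "\<dots> < \<infinity>"
    using G(2) \<open>h > 0\<close> by (cases "entropy G") (auto simp: step_functional_def)
  finally show "entropy F < \<infinity>"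
    using \<open>h > 0\<close> by (cases "entropy F") (auto simp: step_functional_def)
qed

text \<open>\<open>F0\<close>, \<open>F\<close> and the competitor all have variance
  \<open>CARD('d) * \<theta>\<close> about \<open>u\<close>, so in the squared distances to
  \<open>T\<close> only the cross terms differ. The result is an inequality because the coupling
  through \<open>T\<close> and \<open>S\<close> merely bounds the new cost from above, whereas
  \<open>opt\<close> gives the old cost exactly.\<close>

lemma minimizer_pushforward_inequality:
  fixes F :: "real ^ 'd \<Rightarrow> real"
  assumes \<theta>: "\<theta> > 0" and h: "h > 0" and F0: "F0 \<in> constraint_set u \<theta>"
    and min: "is_minimizer_on (step_functional \<theta> h F0) (constraint_set u \<theta>) F"
    and T[measurable]: "T \<in> borel_measurable borel" and distr_T: "distr (dens F) borel T = dens F0"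
    and opt: "W2_sq F0 F = 1 / 2 * (LINT v|dens F. (norm (T v - v))\<^sup>2)"
    and [measurable]: "J \<in> borel_measurable borel" "S \<in> borel_measurable borel" "Q \<in> borel_measurable borel"
    and pos: "\<And>v. 0 < J v" and vol: "distr (dens J) borel S = lborel" and inv: "\<And>v. Q (S v) = v"
    and iS: "integrable (dens F) (\<lambda>v. (norm (S v))\<^sup>2)"
    and S_mean: "(LINT v|dens F. S v) = u"
    and S_var: "(LINT v|dens F. (norm (S v - u))\<^sup>2) = real CARD('d) * \<theta>"
    and iJ: "integrable (dens F) (\<lambda>v. ln (J v))"
  shows "h * (LINT v|dens F. ln (J v))
    \<le> ((LINT v|dens F. (T v - u) \<bullet> (v - u)) - (LINT v|dens F. (T v - u) \<bullet> (S v - u))) / \<theta>"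
proof -
  have F: "F \<in> constraint_set u \<theta>" using min by (simp add: is_minimizer_on_def)
  note Fs = constraint_setD[OF F] and F0s = constraint_setD[OF F0]
  note [measurable] = Fs(2) F0s(2)
  interpret prob_space "dens F" by (rule Fs)
  define G where "G w = F (Q w) / J (Q w)" for w
  have [measurable]: "G \<in> borel_measurable borel" unfolding G_def by measurable
  have nnG: "0 \<le> G w" for w using Fs(3) pos by (simp add: G_def less_imp_le)
  have distr: "distr (dens F) borel S = dens G"
    unfolding G_def by (rule distr_dens_change_of_variables) (use Fs(3) pos vol inv in auto)
  have G: "G \<in> constraint_set u \<theta>"
    by (subst constraint_set_pushforward[OF _ _ nnG Fs(4) distr iS]) (simp_all add: S_mean S_var)
  have iE: "integrable (dens F) (\<lambda>v. ln (F v))"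
    by (rule minimizer_entropy_integrable[OF \<theta> h min])
  \<comment> \<open>By the convention \<open>ln 0 = 0\<close>, the logarithm of
    \<open>F v / J v\<close> need not split at zeros of \<open>F\<close>; these are null for
    \<open>dens F\<close>.\<close>
  have "AE v in dens F. 0 < F v"
    by (subst AE_density) auto
  then have lnG: "AE v in dens F. ln (G (S v)) = ln (F v) - ln (J v)"
  proof eventually_elim
    case (elim v)
    then show ?case using pos[of v] by (simp add: G_def inv ln_div)
  qed
  have iGS: "integrable (dens F) (\<lambda>v. ln (G (S v)))"
    using iE iJ by (subst integrable_cong_AE[OF _ _ lnG]) auto
  have "Defs.entropy G = ereal (LINT v|dens G. ln (G v))"
  proof (rule entropy_eq_integral[OF nnG])
    show "integrable (dens G) (\<lambda>v. ln (G v))"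
      unfolding distr[symmetric] using iGS by (subst integrable_distr_eq) auto
  qed simp
  also have "(LINT v|dens G. ln (G v)) = (LINT v|dens F. ln (G (S v)))"
    unfolding distr[symmetric] by (subst integral_distr) auto
  also have "\<dots> = (LINT v|dens F. ln (F v) - ln (J v))"
    using lnG by (intro integral_cong_AE) auto
  also have "\<dots> = (LINT v|dens F. ln (F v)) - (LINT v|dens F. ln (J v))"
    using iE iJ by simp
  finally have eG: "Defs.entropy G = ereal ((LINT v|dens F. ln (F v)) - (LINT v|dens F. ln (J v)))" .
  have eF: "Defs.entropy F = ereal (LINT v|dens F. ln (F v))"
    by (rule entropy_eq_integral[OF Fs(3) Fs(2) iE])
  have iT2: "integrable (dens F) (\<lambda>v. (norm (T v))\<^sup>2)"
    using F0s(5) unfolding distr_T[symmetric] by (simp add: integrable_distr_eq)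
  have iTu: "integrable (dens F) (\<lambda>v. (norm (T v - u))\<^sup>2)"
    by (rule integrable_norm_diff_sq[OF _ _ iT2]) simp_all
  have T_var: "(LINT v|dens F. (norm (T v - u))\<^sup>2) = real CARD('d) * \<theta>"
    using F0s(8) unfolding distr_T[symmetric] by (simp add: integral_distr)
  have cost: "(LINT v|dens F. (norm (T v - X v))\<^sup>2)
      = 2 * (real CARD('d) * \<theta>) - 2 * (LINT v|dens F. (T v - u) \<bullet> (X v - u))"
    if [measurable]: "X \<in> borel_measurable borel" and iX: "integrable (dens F) (\<lambda>v. (norm (X v))\<^sup>2)"
      and var: "(LINT v|dens F. (norm (X v - u))\<^sup>2) = real CARD('d) * \<theta>" for X
  proof -
    have iXu: "integrable (dens F) (\<lambda>v. (norm (X v - u))\<^sup>2)"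
      by (rule integrable_norm_diff_sq[OF _ _ iX]) simp_all
    have i: "integrable (dens F) (\<lambda>v. (T v - u) \<bullet> (X v - u))"
      by (rule integrable_inner_of_norm_square[OF _ _ iTu iXu]) simp_all
    have "(norm (T v - X v))\<^sup>2 = (norm (T v - u))\<^sup>2 - 2 * ((T v - u) \<bullet> (X v - u)) + (norm (X v - u))\<^sup>2" for v
      using norm_diff_sq[of "T v - u" "X v - u"] by simp
    then have "(LINT v|dens F. (norm (T v - X v))\<^sup>2) =
        (LINT v|dens F. (norm (T v - u))\<^sup>2) - 2 * (LINT v|dens F. (T v - u) \<bullet> (X v - u)) + (LINT v|dens F. (norm (X v - u))\<^sup>2)"
      using iTu iXu i by simp
    then show ?thesis using T_var var by simp
  qed
  have "W2_sq F0 G \<le> 1 / 2 * (LINT v|dens F. (norm (T v - S v))\<^sup>2)"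
    by (rule W2_sq_le_pushforward[OF T _ distr_T distr])
       (simp_all add: integrable_norm_diff_sq[OF _ _ iT2 iS])
  also have "\<dots> = real CARD('d) * \<theta> - (LINT v|dens F. (T v - u) \<bullet> (S v - u))"
    by (subst cost[OF _ iS S_var]) simp_all
  finally have WG: "W2_sq F0 G / \<theta> \<le> (real CARD('d) * \<theta> - (LINT v|dens F. (T v - u) \<bullet> (S v - u))) / \<theta>"
    using \<theta> by (intro divide_right_mono) auto
  have "W2_sq F0 F = real CARD('d) * \<theta> - (LINT v|dens F. (T v - u) \<bullet> (v - u))"
    unfolding opt by (subst cost[OF _ Fs(5,8)]) simp_all
  then have WF: "W2_sq F0 F / \<theta> = (real CARD('d) * \<theta> - (LINT v|dens F. (T v - u) \<bullet> (v - u))) / \<theta>"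
    by simp
  have "step_functional \<theta> h F0 F \<le> step_functional \<theta> h F0 G"
    using min G by (simp add: is_minimizer_on_def)
  then have "W2_sq F0 F / \<theta> + h * (LINT v|dens F. ln (F v))
      \<le> W2_sq F0 G / \<theta> + h * ((LINT v|dens F. ln (F v)) - (LINT v|dens F. ln (J v)))"
    by (simp add: step_functional_def eF eG)
  then have "h * (LINT v|dens F. ln (J v)) \<le> W2_sq F0 G / \<theta> - W2_sq F0 F / \<theta>"
    by (simp add: algebra_simps)
  also have "\<dots> \<le> (real CARD('d) * \<theta> - (LINT v|dens F. (T v - u) \<bullet> (S v - u))) / \<theta>
      - (real CARD('d) * \<theta> - (LINT v|dens F. (T v - u) \<bullet> (v - u))) / \<theta>"
    using WG WF by linarith
  also have "\<dots> = ((LINT v|dens F. (T v - u) \<bullet> (v - u)) - (LINT v|dens F. (T v - u) \<bullet> (S v - u))) / \<theta>"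
    by (simp add: diff_divide_distrib)
  finally show ?thesis .
qed

text \<open>The right side minus the left, \<open>j\<close>, vanishes at 0 and is nonnegative for
  small \<open>t\<close> of either sign, so 0 is a local minimum and the derivative of
  \<open>j\<close> there is 0. Here \<open>exp (L t)\<close> is the dilation factor, with
  logarithmic derivative \<open>- (C / N)\<close> at 0; the term with \<open>Q\<close> is a
  second-order error.\<close>

lemma first_order_condition_at_zero:
  fixes A B C K P Q N n h \<theta> :: real
  assumes N: "N > 0" and \<theta>: "\<theta> > 0"
    and ineq: "\<forall>\<^sub>F t in at 0. h * (n * L t + t * P - t\<^sup>2 * Q) \<le> (A - exp (L t) * (A + t * B)) / \<theta>"
    and L: "\<And>t. L t = - 1 / 2 * ln ((N + 2 * t * C + t\<^sup>2 * K) / N)"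
  shows "h * (P - n * C / N) = (C * A / N - B) / \<theta>"
proof -
  define j where "j t = (A - exp (L t) * (A + t * B)) / \<theta> - h * (n * L t + t * P - t\<^sup>2 * Q)" for t
  have L0: "L 0 = 0" using N by (simp add: L)
  have dL: "(L has_real_derivative - (C / N)) (at 0)"
  proof -
    have "((\<lambda>t. - 1 / 2 * ln ((N + 2 * t * C + t\<^sup>2 * K) / N)) has_real_derivative - (C / N)) (at 0)"
      using N by (auto intro!: derivative_eq_intros simp: field_simps)
    then show ?thesis by (simp add: L[abs_def])
  qed
  have dj: "(j has_real_derivative (C * A / N - B) / \<theta> - h * (P - n * C / N)) (at 0)"
    unfolding j_def [abs_def]
    using \<theta> by (auto intro!: derivative_eq_intros dL simp: L0 algebra_simps diff_divide_distrib add_divide_distrib)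
  have "j 0 = 0" by (simp add: j_def L0)
  obtain d where d: "d > 0" "\<And>t. t \<noteq> 0 \<Longrightarrow> \<bar>t\<bar> < d \<Longrightarrow> h * (n * L t + t * P - t\<^sup>2 * Q) \<le> (A - exp (L t) * (A + t * B)) / \<theta>"
    using ineq unfolding eventually_at by (auto simp: dist_real_def)
  have "\<forall>t. \<bar>0 - t\<bar> < d \<longrightarrow> j 0 \<le> j t"
  proof (intro allI impI)
    fix t assume "\<bar>0 - t\<bar> < d"
    then show "j 0 \<le> j t" using d(2)[of t] \<open>j 0 = 0\<close> by (cases "t = 0") (auto simp: j_def)
  qed
  from DERIV_local_min[OF dj d(1) this] show ?thesis by simp
qed

section \<open>The weak Euler-Lagrange equation\<close>

lemma compact_support_bounded:
  fixes f :: "'a::euclidean_space \<Rightarrow> 'b::real_normed_vector"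
  assumes cont: "continuous_on UNIV f" and K: "compact K" and zero: "\<And>x. x \<notin> K \<Longrightarrow> f x = 0"
  obtains B where "B \<ge> 0" "\<And>x. norm (f x) \<le> B"
proof -
  have "bounded (f ` K)"
    using K cont by (intro compact_imp_bounded compact_continuous_image) (auto intro: continuous_on_subset)
  then obtain B where "B > 0" "\<And>x. x \<in> K \<Longrightarrow> norm (f x) \<le> B"
    by (auto simp: bounded_pos)
  then show ?thesis using zero that[of B] by (metis less_imp_le norm_zero)
qed

lemma gradient_zero_outside_support:
  assumes "\<And>x. GDERIV \<phi> x :> D x" and x: "x \<notin> closure {x. \<phi> x \<noteq> 0}"
  shows "D x = 0"
proof -
  have "(\<phi> has_derivative (\<lambda>_. 0)) (at x)"
  proof (rule has_derivative_transform_within_open)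
    show "((\<lambda>_. 0) has_derivative (\<lambda>_. 0)) (at x)" by simp
    show "open (- closure {x. \<phi> x \<noteq> 0})" by auto
    show "x \<in> - closure {x. \<phi> x \<noteq> 0}" using x by simp
    show "\<And>y. y \<in> - closure {x. \<phi> x \<noteq> 0} \<Longrightarrow> 0 = \<phi> y"
      using closure_subset[of "{x. \<phi> x \<noteq> 0}"] by auto
  qed
  then have "(\<lambda>h. h \<bullet> D x) = (\<lambda>_. 0)"
    using assms(1)[of x] unfolding gderiv_def by (intro has_derivative_unique)
  then have "D x \<bullet> D x = 0" by meson
  then show ?thesis by simp
qed

lemma GDERIV_continuous_on:
  assumes "\<And>x. GDERIV \<phi> x :> D x"
  shows "continuous_on S \<phi>"
  using assms unfolding gderiv_def
  by (meson continuous_at_imp_continuous_on has_derivative_continuous)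

text \<open>The coefficient of \<open>v - u\<close> comes from the dilation, whose logarithmic
  derivative at 0 is \<open>- (C / N)\<close>. Through the entropy it contributes
  \<open>h * C\<close>, because \<open>N = n * \<theta>\<close>; through the transport cost it
  contributes \<open>C * A / N\<close>, and \<open>A / N\<close> equals
  \<open>1 - W2_sq F0 F / (n * \<theta>)\<close>. The terms with \<open>D\<close> and
  \<open>T\<close> come from the shear itself.\<close>

lemma minimizer_euler_lagrange:
  fixes F :: "real ^ 'd \<Rightarrow> real"
  assumes \<theta>: "\<theta> > 0" and h: "h > 0" and F0: "F0 \<in> constraint_set u \<theta>"
    and min: "is_minimizer_on (step_functional \<theta> h F0) (constraint_set u \<theta>) F"
    and T[measurable]: "T \<in> borel_measurable borel" and distr_T: "distr (dens F) borel T = dens F0"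
    and opt: "W2_sq F0 F = 1 / 2 * (LINT v|dens F. (norm (T v - v))\<^sup>2)"
    and \<phi>: "\<And>x. GDERIV \<phi> x :> D x" and D: "continuous_on UNIV D" and supp: "compact (closure {x. \<phi> x \<noteq> 0})"
    and e: "e \<in> Basis"
  shows "h * \<theta> * (LINT v|dens F. D v \<bullet> e) =
    (LINT v|dens F. \<phi> v * (((h + 1 - W2_sq F0 F / (real CARD('d) * \<theta>)) *\<^sub>R (v - u) - (T v - u)) \<bullet> e))"
proof -
  define n where "n = real CARD('d)"
  have n: "n > 0" by (simp add: n_def)
  have F: "F \<in> constraint_set u \<theta>" using min by (simp add: is_minimizer_on_def)
  note Fs = constraint_setD[OF F] and F0s = constraint_setD[OF F0]
  note [measurable] = Fs(2) F0s(2)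
  interpret prob_space "dens F" by (rule Fs)
  have \<phi>c: "continuous_on UNIV \<phi>" using \<phi> by (rule GDERIV_continuous_on)
  have [measurable]: "\<phi> \<in> borel_measurable borel" "D \<in> borel_measurable borel"
    using \<phi>c D by (simp_all add: borel_measurable_continuous_onI)
  have \<phi>0: "\<phi> x = 0" if "x \<notin> closure {x. \<phi> x \<noteq> 0}" for x
    using that closure_subset[of "{x. \<phi> x \<noteq> 0}"] by auto
  obtain B\<phi> where B\<phi>: "B\<phi> \<ge> 0" "\<And>x. norm (\<phi> x) \<le> B\<phi>"
    using compact_support_bounded[OF \<phi>c supp \<phi>0] by blast
  obtain BD where BD: "BD \<ge> 0" "\<And>x. norm (D x) \<le> BD"
    using compact_support_bounded[OF D supp gradient_zero_outside_support[OF \<phi>]] by blast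
  have e1: "norm e = 1" using e by simp

  have iT2: "integrable (dens F) (\<lambda>v. (norm (T v))\<^sup>2)"
    using F0s(5) unfolding distr_T[symmetric] by (simp add: integrable_distr_eq)
  have iTu2: "integrable (dens F) (\<lambda>v. (norm (T v - u))\<^sup>2)"
    by (rule integrable_norm_diff_sq[OF _ _ iT2]) simp_all
  have ivu2: "integrable (dens F) (\<lambda>v. (norm (v - u))\<^sup>2)"
    by (rule integrable_norm_diff_sq[OF _ _ Fs(5)]) simp_all
  have iTu: "integrable (dens F) (\<lambda>v. T v - u)" by (rule integrable_of_norm_square[OF _ iTu2]) simp
  have ivu: "integrable (dens F) (\<lambda>v. v - u)" by (rule integrable_of_norm_square[OF _ ivu2]) simp
  have iTv: "integrable (dens F) (\<lambda>v. (T v - u) \<bullet> (v - u))"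
    by (rule integrable_inner_of_norm_square[OF _ _ iTu2 ivu2]) simp_all
  have mean_v: "(LINT v|dens F. v - u) = 0"
    using Fs(6,7) prob_space by simp
  have mean_T: "(LINT v|dens F. T v - u) = 0"
  proof -
    have "(LINT v|dens F. T v) = u"
      using F0s(7) unfolding distr_T[symmetric] by (simp add: integral_distr)
    moreover have "integrable (dens F) T" by (rule integrable_of_norm_square[OF _ iT2]) simp
    ultimately show ?thesis using prob_space by simp
  qed

  \<comment> \<open>Centring makes the shear preserve the mean and leaves the gradient
    \<open>D\<close> unchanged. The function \<eta> is no longer compactly supported, but it stays
    bounded.\<close>
  define \<eta> where "\<eta> v = \<phi> v - expectation \<phi>" for v
  have [measurable]: "\<eta> \<in> borel_measurable borel" unfolding \<eta>_def by measurable
  have \<eta>: "GDERIV \<eta> x :> D x" for x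
    using GDERIV_diff[OF \<phi> GDERIV_const] unfolding \<eta>_def by simp
  have i\<phi>: "integrable (dens F) \<phi>" by (rule integrable_const_bound[where B = B\<phi>]) (use B\<phi> in auto)
  have mean_\<eta>: "(LINT v|dens F. \<eta> v) = 0" unfolding \<eta>_def using i\<phi> prob_space by simp
  define B where "B = B\<phi> + \<bar>expectation \<phi>\<bar>"
  have B: "\<bar>\<eta> v\<bar> \<le> B" for v using B\<phi>(2)[of v] unfolding \<eta>_def B_def by simp
  have i\<eta>: "integrable (dens F) \<eta>" by (rule integrable_const_bound[where B = B]) (use B in auto)
  have i\<eta>2: "integrable (dens F) (\<lambda>v. (\<eta> v)\<^sup>2)"
    by (rule integrable_const_bound[where B = "B\<^sup>2"]) (use B in \<open>auto intro!: AE_I2 simp: abs_le_square_iff[symmetric] intro: order_trans[OF _ abs_ge_self]\<close>)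
  have i_bdd: "integrable (dens F) (\<lambda>v. g v * (X v \<bullet> e))"
    if "integrable (dens F) X" "g \<in> borel_measurable borel" "\<And>v. \<bar>g v\<bar> \<le> b" for g X b
  proof (rule Bochner_Integration.integrable_bound)
    show "integrable (dens F) (\<lambda>v. b * (X v \<bullet> e))" using that(1) by simp
    show "AE v in dens F. norm (g v * (X v \<bullet> e)) \<le> norm (b * (X v \<bullet> e))"
      using that(3) by (intro AE_I2) (auto simp: abs_mult intro!: mult_right_mono intro: order_trans[OF _ abs_ge_self])
  qed (use that borel_measurable_integrable[OF that(1)] in simp)

  define A where "A = (LINT v|dens F. (T v - u) \<bullet> (v - u))"
  define C where "C = (LINT v|dens F. \<eta> v * ((v - u) \<bullet> e))"
  define E where "E = (LINT v|dens F. \<eta> v * ((T v - u) \<bullet> e))"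
  define K where "K = (LINT v|dens F. (\<eta> v)\<^sup>2)"
  define N where "N = n * \<theta>"
  have N: "N > 0" using n \<theta> by (simp add: N_def)
  define P where "P = (LINT v|dens F. D v \<bullet> e)"
  define R where "R = (LINT v|dens F. 2 * (D v \<bullet> e)\<^sup>2)"
  \<comment> \<open>The variance after the shear by \<open>t * \<eta>\<close> is
    \<open>N + 2 * t * C + t\<^sup>2 * K\<close>, so dilation by \<open>exp (L t)\<close> brings it
    back to \<open>N\<close>.\<close>
  define L where "L t = - 1 / 2 * ln ((N + 2 * t * C + t\<^sup>2 * K) / N)" for t
  have De: "\<bar>D v \<bullet> e\<bar> \<le> BD" for v
    using Cauchy_Schwarz_ineq2[of "D v" e] BD(2)[of v] e1 by simp
  have iDe: "integrable (dens F) (\<lambda>v. D v \<bullet> e)"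
    by (rule integrable_const_bound[where B = BD]) (use De in auto)
  have iDe2: "integrable (dens F) (\<lambda>v. (D v \<bullet> e)\<^sup>2)"
    by (rule integrable_const_bound[where B = "BD\<^sup>2"]) (use De in \<open>auto intro!: AE_I2 simp: abs_le_square_iff[symmetric] intro: order_trans[OF _ abs_ge_self]\<close>)

  \<comment> \<open>The bound \<open>1 / 2\<close> makes the displacement a contraction, keeps the
    Jacobian positive and admits the quadratic estimate of the logarithm below.\<close>
  have ineq: "h * (n * L t + t * P - t\<^sup>2 * R) \<le> (A - exp (L t) * (A + t * E)) / \<theta>"
    if t: "\<bar>t\<bar> * BD \<le> 1 / 2" and pos: "N + 2 * t * C + t\<^sup>2 * K > 0" for t
  proof -
    define a where "a = exp (L t)"
    have a: "a > 0" by (simp add: a_def)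
    have a2: "a\<^sup>2 = N / (N + 2 * t * C + t\<^sup>2 * K)"
    proof -
      have "a\<^sup>2 = exp (2 * L t)" by (simp add: a_def exp_double)
      also have "2 * L t = - ln ((N + 2 * t * C + t\<^sup>2 * K) / N)" by (simp add: L_def)
      finally show ?thesis using N pos by (simp add: exp_minus)
    qed
    define S where "S v = u + a *\<^sub>R (v + (t * \<eta> v) *\<^sub>R e - u)" for v
    define J where "J v = a ^ CARD('d) * (1 + (t *\<^sub>R D v) \<bullet> e)" for v
    have grad: "GDERIV (\<lambda>v. t * \<eta> v) x :> t *\<^sub>R D x" for x
      using GDERIV_mult[OF GDERIV_const[of t] \<eta>] by simp
    have bound: "norm (t *\<^sub>R D x) \<le> 1 / 2" for x
      using mult_left_mono[OF BD(2)[of x] abs_ge_zero[of t]] t by simp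
    have tDe: "\<bar>t * (D v \<bullet> e)\<bar> \<le> 1 / 2" for v
      using mult_left_mono[OF De[of v] abs_ge_zero[of t]] t by (simp add: abs_mult)
    have posJ: "1 + t * (D v \<bullet> e) > 0" for v using tDe[of v] by linarith
    obtain Q0 where Q0[measurable]: "Q0 \<in> borel_measurable borel" and Q0S: "\<And>x. Q0 (x + (t * \<eta> x) *\<^sub>R e) = x"
      by (rule shear_inverse[OF e1 lipschitz_of_gradient_bound[OF grad bound]]) auto
    define Q where "Q w = Q0 (u + (1 / a) *\<^sub>R (w - u))" for w
    have [measurable]: "S \<in> borel_measurable borel" "J \<in> borel_measurable borel" "Q \<in> borel_measurable borel"
      unfolding S_def J_def Q_def by measurable
    have Su: "S v - u = a *\<^sub>R ((v - u) + (t * \<eta> v) *\<^sub>R e)" for v by (simp add: S_def algebra_simps)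
    have nS: "(norm (S v - u))\<^sup>2 = a\<^sup>2 * ((norm (v - u))\<^sup>2 + 2 * t * (\<eta> v * ((v - u) \<bullet> e)) + t\<^sup>2 * (\<eta> v)\<^sup>2)" for v
    proof -
      have "(norm ((v - u) + (t * \<eta> v) *\<^sub>R e))\<^sup>2 = (norm (v - u))\<^sup>2 + 2 * ((v - u) \<bullet> ((t * \<eta> v) *\<^sub>R e)) + (norm ((t * \<eta> v) *\<^sub>R e))\<^sup>2"
        using norm_diff_sq[of "v - u" "- ((t * \<eta> v) *\<^sub>R e)"] by simp
      also have "\<dots> = (norm (v - u))\<^sup>2 + 2 * t * (\<eta> v * ((v - u) \<bullet> e)) + t\<^sup>2 * (\<eta> v)\<^sup>2"
        using e1 by (simp add: power_mult_distrib)
      finally show ?thesis by (simp only: Su norm_scaleR power_mult_distrib power2_abs)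
    qed
    have i\<eta>v: "integrable (dens F) (\<lambda>v. \<eta> v * ((v - u) \<bullet> e))" by (rule i_bdd[OF ivu _ B]) simp
    have i\<eta>T: "integrable (dens F) (\<lambda>v. \<eta> v * ((T v - u) \<bullet> e))" by (rule i_bdd[OF iTu _ B]) simp
    have iSu: "integrable (dens F) (\<lambda>v. (norm (S v - u))\<^sup>2)"
      unfolding nS using ivu2 i\<eta>v i\<eta>2 by (intro integrable_mult_right Bochner_Integration.integrable_add) auto
    have iS: "integrable (dens F) (\<lambda>v. (norm (S v))\<^sup>2)"
      using integrable_norm_diff_sq[of "\<lambda>v. S v - u" "dens F" "\<lambda>_. - u", OF _ _ iSu] by simp
    have S_mean: "(LINT v|dens F. S v) = u"
    proof -
      have "(LINT v|dens F. S v) = (LINT v|dens F. u + (a *\<^sub>R (v - u) + (a * t) *\<^sub>R (\<eta> v *\<^sub>R e)))"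
        by (simp add: S_def algebra_simps)
      also have "\<dots> = (LINT v|dens F. u) + (a *\<^sub>R (LINT v|dens F. v - u) + (a * t) *\<^sub>R ((LINT v|dens F. \<eta> v) *\<^sub>R e))"
        using ivu i\<eta> by (simp del: integral_diff)
      also have "\<dots> = u" using mean_v mean_\<eta> prob_space by (simp del: integral_diff)
      finally show ?thesis .
    qed
    have S_var: "(LINT v|dens F. (norm (S v - u))\<^sup>2) = real CARD('d) * \<theta>"
    proof -
      have "(LINT v|dens F. (norm (S v - u))\<^sup>2) = a\<^sup>2 * (N + 2 * t * C + t\<^sup>2 * K)"
        unfolding nS using ivu2 i\<eta>v i\<eta>2 Fs(8) by (simp add: C_def K_def N_def n_def)
      also have "\<dots> = N" using a2 pos by simp
      finally show ?thesis by (simp add: N_def n_def)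
    qed
    have lnJ: "ln (J v) = n * L t + ln (1 + t * (D v \<bullet> e))" for v
      using posJ[of v] a by (simp add: J_def ln_mult ln_realpow n_def a_def)
    have ln_le: "ln (1 + t * (D v \<bullet> e)) \<le> t * (D v \<bullet> e)" for v
      using ln_le_minus_one[OF posJ[of v]] by simp
    \<comment> \<open>From \<open>\<bar>ln (1 + x) - x\<bar> \<le> 2 * x\<^sup>2\<close> for
      \<open>\<bar>x\<bar> \<le> 1 / 2\<close>. Only this lower bound enters the inequality; it
      replaces differentiation under the integral and is the origin of \<open>R\<close>.\<close>
    have ln_ge: "t * (D v \<bullet> e) - t\<^sup>2 * (2 * (D v \<bullet> e)\<^sup>2) \<le> ln (1 + t * (D v \<bullet> e))" for v
      using abs_ln_one_plus_x_minus_x_bound[OF tDe[of v]] by (simp add: power_mult_distrib)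
    have iln: "integrable (dens F) (\<lambda>v. ln (1 + t * (D v \<bullet> e)))"
    proof (rule integrable_between[where f = "\<lambda>v. t * (D v \<bullet> e) - t\<^sup>2 * (2 * (D v \<bullet> e)\<^sup>2)" and h = "\<lambda>v. t * (D v \<bullet> e)"])
      show "integrable (dens F) (\<lambda>v. t * (D v \<bullet> e) - t\<^sup>2 * (2 * (D v \<bullet> e)\<^sup>2))"
        by (intro Bochner_Integration.integrable_diff integrable_mult_right iDe iDe2)
      show "integrable (dens F) (\<lambda>v. t * (D v \<bullet> e))" by (intro integrable_mult_right iDe)
    qed (use ln_le ln_ge in auto)
    have iJ: "integrable (dens F) (\<lambda>v. ln (J v))"
      unfolding lnJ by (intro Bochner_Integration.integrable_add integrable_const iln)
    have "h * (LINT v|dens F. ln (J v))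
      \<le> ((LINT v|dens F. (T v - u) \<bullet> (v - u)) - (LINT v|dens F. (T v - u) \<bullet> (S v - u))) / \<theta>"
    proof (rule minimizer_pushforward_inequality[OF \<theta> h F0 min T distr_T opt _ _ _ _ _ _ iS S_mean S_var iJ])
      show "0 < J v" for v using posJ[of v] a by (simp add: J_def)
      show "Q (S v) = v" for v using Q0S[of v] a by (simp add: Q_def S_def)
      show "distr (dens J) borel S = lborel"
        using distr_scaled_shear_lborel[OF e grad _ bound _ a, of u] continuous_on_scaleR[OF continuous_on_const D]
        unfolding J_def S_def by simp
    qed simp_all
    moreover have "(LINT v|dens F. (T v - u) \<bullet> (S v - u)) = a * (A + t * E)"
    proof -
      have "(T v - u) \<bullet> (S v - u) = a * ((T v - u) \<bullet> (v - u) + t * (\<eta> v * ((T v - u) \<bullet> e)))" for v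
        unfolding Su by (simp add: inner_add_right algebra_simps)
      then show ?thesis using iTv i\<eta>T by (simp add: A_def E_def)
    qed
    moreover have "n * L t + t * P - t\<^sup>2 * R \<le> (LINT v|dens F. ln (J v))"
    proof -
      have "n * L t + t * P - t\<^sup>2 * R = n * L t + (LINT v|dens F. t * (D v \<bullet> e) - t\<^sup>2 * (2 * (D v \<bullet> e)\<^sup>2))"
        using iDe iDe2 by (simp add: P_def R_def)
      also have "\<dots> \<le> n * L t + (LINT v|dens F. ln (1 + t * (D v \<bullet> e)))"
        by (intro add_left_mono integral_mono iln ln_ge Bochner_Integration.integrable_diff integrable_mult_right iDe iDe2)
      also have "\<dots> = (LINT v|dens F. ln (J v))"
        unfolding lnJ using iln prob_space by simp
      finally show ?thesis .
    qed
    ultimately have "h * (LINT v|dens F. ln (J v)) \<le> (A - a * (A + t * E)) / \<theta>"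
      and "h * (n * L t + t * P - t\<^sup>2 * R) \<le> h * (LINT v|dens F. ln (J v))"
      using h by (simp_all add: A_def)
    then show ?thesis unfolding a_def[symmetric] by linarith
  qed
  have "\<forall>\<^sub>F t in at 0. \<bar>t\<bar> * BD < 1 / 2"
    by (rule order_tendstoD(2)[where y = 0]) (auto intro!: tendsto_eq_intros)
  moreover have "\<forall>\<^sub>F t in at 0. 0 < N + 2 * t * C + t\<^sup>2 * K"
    by (rule order_tendstoD(1)[where y = N]) (use N in \<open>auto intro!: tendsto_eq_intros\<close>)
  ultimately have "\<forall>\<^sub>F t in at 0. h * (n * L t + t * P - t\<^sup>2 * R) \<le> (A - exp (L t) * (A + t * E)) / \<theta>"
    by eventually_elim (rule ineq, auto)
  from first_order_condition_at_zero[OF N \<theta> this L_def]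
  have "h * (P - n * C / N) = (C * A / N - E) / \<theta>" .
  then have "\<theta> * (h * (P - n * C / N)) = C * A / N - E" using \<theta> by (simp add: field_simps)
  moreover have "\<theta> * (h * (P - n * C / N)) = h * \<theta> * P - h * C"
    using \<theta> n by (simp add: N_def field_simps)
  ultimately have key: "h * \<theta> * P = h * C + C * A / N - E" by linarith
  have A: "A / N = 1 - W2_sq F0 F / (n * \<theta>)"
  proof -
    have "(norm (T v - v))\<^sup>2 = (norm (T v - u))\<^sup>2 - 2 * ((T v - u) \<bullet> (v - u)) + (norm (v - u))\<^sup>2" for v
      using norm_diff_sq[of "T v - u" "v - u"] by simp
    moreover have "(LINT v|dens F. (norm (T v - u))\<^sup>2) = N"
      using F0s(8) unfolding distr_T[symmetric] by (simp add: integral_distr N_def n_def)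
    ultimately have "W2_sq F0 F = N - A"
      unfolding opt using iTu2 ivu2 iTv Fs(8) by (simp add: A_def N_def n_def)
    then have "A / N = 1 - W2_sq F0 F / N" using N by (simp add: field_simps)
    then show ?thesis by (simp add: N_def)
  qed
  have i\<phi>v: "integrable (dens F) (\<lambda>v. \<phi> v * ((v - u) \<bullet> e))" by (rule i_bdd[OF ivu]) (use B\<phi> in auto)
  have i\<phi>T: "integrable (dens F) (\<lambda>v. \<phi> v * ((T v - u) \<bullet> e))" by (rule i_bdd[OF iTu]) (use B\<phi> in auto)
  \<comment> \<open>The centring constant drops out because \<open>v - u\<close> has mean zero; for
    \<open>E\<close> the same holds with \<open>T v - u\<close>, since \<open>T\<close> carries
    \<open>F\<close> to \<open>F0\<close>, which also has mean \<open>u\<close>.\<close>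
  have C: "C = (LINT v|dens F. \<phi> v * ((v - u) \<bullet> e))"
  proof -
    have "C = (LINT v|dens F. \<phi> v * ((v - u) \<bullet> e) - expectation \<phi> * ((v - u) \<bullet> e))"
      by (simp add: C_def \<eta>_def left_diff_distrib)
    also have "\<dots> = (LINT v|dens F. \<phi> v * ((v - u) \<bullet> e)) - expectation \<phi> * ((LINT v|dens F. v - u) \<bullet> e)"
      using i\<phi>v ivu by (simp del: Bochner_Integration.integral_diff add: Bochner_Integration.integral_diff[OF i\<phi>v])
    finally show ?thesis by (simp only: mean_v) simp
  qed
  have E: "E = (LINT v|dens F. \<phi> v * ((T v - u) \<bullet> e))"
  proof -
    have "E = (LINT v|dens F. \<phi> v * ((T v - u) \<bullet> e) - expectation \<phi> * ((T v - u) \<bullet> e))"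
      by (simp add: E_def \<eta>_def left_diff_distrib)
    also have "\<dots> = (LINT v|dens F. \<phi> v * ((T v - u) \<bullet> e)) - expectation \<phi> * ((LINT v|dens F. T v - u) \<bullet> e)"
      using i\<phi>T iTu by (simp del: Bochner_Integration.integral_diff add: Bochner_Integration.integral_diff[OF i\<phi>T])
    finally show ?thesis by (simp only: mean_T) simp
  qed
  define \<kappa> where "\<kappa> = h + 1 - W2_sq F0 F / (n * \<theta>)"
  have "(LINT v|dens F. \<phi> v * ((\<kappa> *\<^sub>R (v - u) - (T v - u)) \<bullet> e))
      = (LINT v|dens F. \<kappa> * (\<phi> v * ((v - u) \<bullet> e)) - \<phi> v * ((T v - u) \<bullet> e))"
    by (intro Bochner_Integration.integral_cong refl) (simp add: inner_diff_left algebra_simps)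
  also have "\<dots> = \<kappa> * C - E"
    using i\<phi>v i\<phi>T by (simp add: C E)
  also have "\<dots> = h * \<theta> * P"
  proof -
    have "\<kappa> = h + A / N" by (simp add: \<kappa>_def A)
    then show ?thesis unfolding key by (simp add: algebra_simps)
  qed
  finally show ?thesis by (simp add: P_def \<kappa>_def n_def)
qed

section \<open>Weak gradients\<close>

text \<open>Local integrability yields measurability only of the truncations to compact sets;
  \<open>f\<close> is the pointwise limit of its truncations to growing balls.\<close>

lemma locally_integrable_measurable:
  fixes f :: "real ^ 'd \<Rightarrow> 'b::{banach, second_countable_topology}"
  assumes "locally_integrable f"
  shows "f \<in> borel_measurable borel"
proof -
  have m: "(\<lambda>x. indicator (cball 0 (real n)) x *\<^sub>R f x) \<in> borel_measurable borel" for n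
    using assms borel_measurable_integrable[of lborel "\<lambda>x. indicator (cball 0 (real n)) x *\<^sub>R f x"]
    unfolding locally_integrable_def set_integrable_def by auto
  show ?thesis
  proof (rule borel_measurable_LIMSEQ_metric)
    show "(\<lambda>x. indicator (cball 0 (real n)) x *\<^sub>R f x) \<in> borel_measurable borel" for n by (rule m)
    fix x :: "real ^ 'd"
    obtain N where N: "norm x \<le> real N" using real_arch_simple by blast
    have "\<forall>\<^sub>F n in sequentially. f x = indicator (cball 0 (real n)) x *\<^sub>R f x"
      using eventually_ge_at_top[of N] by eventually_elim (use N in auto)
    then show "(\<lambda>n. indicator (cball 0 (real n)) x *\<^sub>R f x) \<longlonglongrightarrow> f x"
      by (rule Lim_transform_eventually[OF tendsto_const])
  qed
qed

lemma integrable_compact_support_scaleR: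
  fixes f :: "real ^ 'd \<Rightarrow> 'b::{banach, second_countable_topology}" and m :: "real ^ 'd \<Rightarrow> real"
  assumes f: "locally_integrable f" and m: "m \<in> borel_measurable borel"
    and K: "compact K" and bound: "\<And>x. x \<in> K \<Longrightarrow> \<bar>m x\<bar> \<le> B" and zero: "\<And>x. x \<notin> K \<Longrightarrow> m x = 0"
  shows "integrable lborel (\<lambda>x. m x *\<^sub>R f x)"
proof (rule Bochner_Integration.integrable_bound)
  show "integrable lborel (\<lambda>x. B *\<^sub>R (indicator K x *\<^sub>R f x))"
    using f K unfolding locally_integrable_def set_integrable_def by (intro integrable_scaleR_right) auto
  show "AE x in lborel. norm (m x *\<^sub>R f x) \<le> norm (B *\<^sub>R (indicator K x *\<^sub>R f x))"
  proof (rule AE_I2)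
    fix x
    show "norm (m x *\<^sub>R f x) \<le> norm (B *\<^sub>R (indicator K x *\<^sub>R f x))"
      using bound[of x] zero[of x] by (cases "x \<in> K") (auto intro!: mult_right_mono)
  qed
qed (use m locally_integrable_measurable[OF f] in simp)

lemma locally_integrable_scaleR_continuous:
  fixes f :: "real ^ 'd \<Rightarrow> 'b::{banach, second_countable_topology}"
  assumes f: "locally_integrable f" and m: "continuous_on UNIV m"
  shows "locally_integrable (\<lambda>x. m x *\<^sub>R f x)"
  unfolding locally_integrable_def set_integrable_def
proof (intro allI impI)
  fix K :: "(real ^ 'd) set" assume K: "compact K"
  have "bounded (m ` K)"
    using K m by (intro compact_imp_bounded compact_continuous_image) (auto intro: continuous_on_subset)
  then obtain B where B: "\<And>x. x \<in> K \<Longrightarrow> \<bar>m x\<bar> \<le> B" by (auto simp: bounded_iff)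
  have [measurable]: "m \<in> borel_measurable borel" "K \<in> sets borel"
    using m K by (auto intro: borel_measurable_continuous_onI borel_compact)
  have "integrable lborel (\<lambda>x. (indicator K x * m x) *\<^sub>R f x)"
    by (rule integrable_compact_support_scaleR[OF f _ K, where B = B]) (use B in auto)
  then show "integrable lborel (\<lambda>x. indicator K x *\<^sub>R (m x *\<^sub>R f x))" by simp
qed

text \<open>The product \<open>m x * \<phi> x\<close> is again a compactly supported test function
  with continuous gradient, so the weak gradient of \<open>f\<close> may be tested against it. The
  product rule splits off \<open>f x *\<^sub>R Dm x\<close>, whose integral against \<phi> moves to
  the other side.\<close>

lemma has_weak_gradient_mult:
  fixes f m :: "real ^ 'd \<Rightarrow> real"
  assumes f: "has_weak_gradient f g" and m: "\<And>x. GDERIV m x :> Dm x" and Dm: "continuous_on UNIV Dm"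
    and fDm: "locally_integrable (\<lambda>x. f x *\<^sub>R Dm x)"
  shows "has_weak_gradient (\<lambda>x. m x * f x) (\<lambda>x. m x *\<^sub>R g x + f x *\<^sub>R Dm x)"
proof -
  have mc: "continuous_on UNIV m" using m by (rule GDERIV_continuous_on)
  have lf: "locally_integrable f" and lg: "locally_integrable g"
    using f by (auto simp: has_weak_gradient_def)
  have lmf: "locally_integrable (\<lambda>x. m x * f x)" and lmg: "locally_integrable (\<lambda>x. m x *\<^sub>R g x)"
    using locally_integrable_scaleR_continuous[OF lf mc] locally_integrable_scaleR_continuous[OF lg mc] by auto
  have "locally_integrable (\<lambda>x. m x *\<^sub>R g x + f x *\<^sub>R Dm x)"
    using lmg fDm by (auto simp: locally_integrable_def intro!: set_integral_add(1))
  moreover have "(LINT x|lborel. (m x * f x) *\<^sub>R D x) = - (LINT x|lborel. \<phi> x *\<^sub>R (m x *\<^sub>R g x + f x *\<^sub>R Dm x))"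
    if \<phi>: "\<And>x. GDERIV \<phi> x :> D x" and D: "continuous_on UNIV D" and supp: "compact (closure {x. \<phi> x \<noteq> 0})"
    for \<phi> :: "real ^ 'd \<Rightarrow> real" and D
  proof -
    have \<phi>c: "continuous_on UNIV \<phi>" using \<phi> by (rule GDERIV_continuous_on)
    have [measurable]: "\<phi> \<in> borel_measurable borel" "D \<in> borel_measurable borel"
      using \<phi>c D by (auto intro: borel_measurable_continuous_onI)
    have \<phi>0: "\<phi> x = 0" if "x \<notin> closure {x. \<phi> x \<noteq> 0}" for x
      using that closure_subset[of "{x. \<phi> x \<noteq> 0}"] by auto
    obtain B where "\<And>x. norm (\<phi> x) \<le> B"
      using compact_support_bounded[OF \<phi>c supp \<phi>0] by blast
    then have B: "\<bar>\<phi> x\<bar> \<le> B" if "x \<in> closure {x. \<phi> x \<noteq> 0}" for x by simp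
    have ifD: "integrable lborel (\<lambda>x. \<phi> x *\<^sub>R (f x *\<^sub>R Dm x))"
      by (rule integrable_compact_support_scaleR[OF fDm _ supp B \<phi>0]) simp_all
    have img: "integrable lborel (\<lambda>x. \<phi> x *\<^sub>R (m x *\<^sub>R g x))"
      by (rule integrable_compact_support_scaleR[OF lmg _ supp B \<phi>0]) simp_all
    have prod: "GDERIV (\<lambda>x. m x * \<phi> x) x :> m x *\<^sub>R D x + \<phi> x *\<^sub>R Dm x" for x
      using GDERIV_mult[OF m \<phi>] by simp
    have contprod: "continuous_on UNIV (\<lambda>x. m x *\<^sub>R D x + \<phi> x *\<^sub>R Dm x)"
      by (intro continuous_intros mc D \<phi>c Dm)
    have "closure {x. m x * \<phi> x \<noteq> 0} \<subseteq> closure {x. \<phi> x \<noteq> 0}"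
      by (intro closure_mono) auto
    then have supp': "compact (closure {x. m x * \<phi> x \<noteq> 0})"
      using supp by (meson closed_closure closed_subset compact_eq_bounded_closed bounded_subset)
    have weak: "(LINT x|lborel. f x *\<^sub>R (m x *\<^sub>R D x + \<phi> x *\<^sub>R Dm x)) = - (LINT x|lborel. (m x * \<phi> x) *\<^sub>R g x)"
      by (rule f[unfolded has_weak_gradient_def, THEN conjunct2, THEN conjunct2, THEN spec, THEN spec, THEN mp])
         (intro conjI allI prod contprod supp')
    have ifD': "integrable lborel (\<lambda>x. f x *\<^sub>R (m x *\<^sub>R D x + \<phi> x *\<^sub>R Dm x))"
    proof -
      have z: "m x *\<^sub>R D x + \<phi> x *\<^sub>R Dm x = 0" if "x \<notin> closure {x. \<phi> x \<noteq> 0}" for x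
        using \<phi>0[OF that] gradient_zero_outside_support[OF \<phi> that] by simp
      obtain C where C: "\<And>x. norm (m x *\<^sub>R D x + \<phi> x *\<^sub>R Dm x) \<le> C"
        using compact_support_bounded[OF contprod supp z] by blast
      show ?thesis
      proof (rule Bochner_Integration.integrable_bound)
        let ?K = "closure {x. \<phi> x \<noteq> 0}"
        show "integrable lborel (\<lambda>x. C *\<^sub>R (indicator ?K x *\<^sub>R f x))"
          using lf supp unfolding locally_integrable_def set_integrable_def by (intro integrable_scaleR_right) auto
        show "AE x in lborel. norm (f x *\<^sub>R (m x *\<^sub>R D x + \<phi> x *\<^sub>R Dm x)) \<le> norm (C *\<^sub>R (indicator ?K x *\<^sub>R f x))"
        proof (rule AE_I2)
          fix x
          have "norm (f x *\<^sub>R (m x *\<^sub>R D x + \<phi> x *\<^sub>R Dm x)) \<le> \<bar>f x\<bar> * C"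
            using C[of x] by (simp add: mult_left_mono)
          also have "\<dots> \<le> \<bar>f x\<bar> * \<bar>C\<bar>" by (intro mult_left_mono) auto
          finally show "norm (f x *\<^sub>R (m x *\<^sub>R D x + \<phi> x *\<^sub>R Dm x)) \<le> norm (C *\<^sub>R (indicator ?K x *\<^sub>R f x))"
            using z[of x] by (cases "x \<in> ?K") (simp_all add: mult.commute)
        qed
      qed (use locally_integrable_measurable[OF lf] borel_measurable_continuous_onI[OF contprod] in simp)
    qed
    have "(LINT x|lborel. (m x * f x) *\<^sub>R D x) = (LINT x|lborel. f x *\<^sub>R (m x *\<^sub>R D x + \<phi> x *\<^sub>R Dm x) - \<phi> x *\<^sub>R (f x *\<^sub>R Dm x))"
      by (intro Bochner_Integration.integral_cong refl) (simp add: algebra_simps)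
    also have "\<dots> = - (LINT x|lborel. \<phi> x *\<^sub>R (m x *\<^sub>R g x)) - (LINT x|lborel. \<phi> x *\<^sub>R (f x *\<^sub>R Dm x))"
      by (subst Bochner_Integration.integral_diff[OF ifD' ifD]) (simp add: weak mult.commute)
    also have "\<dots> = - (LINT x|lborel. \<phi> x *\<^sub>R (m x *\<^sub>R g x + f x *\<^sub>R Dm x))"
      using Bochner_Integration.integral_add[OF img ifD] by (simp add: scaleR_add_right)
    finally show ?thesis .
  qed
  ultimately show ?thesis using lmf by (simp add: has_weak_gradient_def)
qed

lemma integrable_imp_locally_integrable:
  "integrable lborel f \<Longrightarrow> locally_integrable f"
  unfolding locally_integrable_def set_integrable_def
  by (auto intro!: integrable_mult_indicator borel_compact)

section \<open>Finite Fisher information and the formula for the optimal map\<close>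

theorem theorem4p1:
  fixes u :: "real ^ 'd" and \<theta> h :: real
    and F0 F1 \<psi> :: "real ^ 'd \<Rightarrow> real"
  assumes "\<theta> > 0" and "h > 0"
    and "F0 \<in> constraint_set u \<theta>"
    and "is_minimizer_on (step_functional \<theta> h F0) (constraint_set u \<theta>) F1"
    and "convex_on UNIV \<psi>"
    and "push_forward_eq (grad \<psi>) F1 F0"
  shows "\<exists>l k. has_weak_log_gradient F1 l \<and>
           has_weak_log_gradient (\<lambda>v. F1 v / maxwellian F1 v) k \<and>
           (\<integral>\<^sup>+ v. ennreal ((norm (l v))\<^sup>2 * F1 v) \<partial>lborel) < \<infinity> \<and>
           (AE v in density lborel (\<lambda>v. ennreal (F1 v)).
              grad \<psi> v = v + (h * \<theta>) *\<^sub>R k v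
                + (W2_sq F1 F0 / (real CARD('d) * \<theta>)) *\<^sub>R (u - v))"
proof -
  note \<theta> = assms(1) and h = assms(2) and F0 = assms(3) and min = assms(4) and convex = assms(5) and push = assms(6)
  have F1: "F1 \<in> constraint_set u \<theta>" using min by (simp add: is_minimizer_on_def)
  note F1s = constraint_setD[OF F1] and F0s = constraint_setD[OF F0]
  note [measurable] = F1s(2) F0s(2)
  define T where "T = grad \<psi>"
  have T[measurable]: "T \<in> borel_measurable borel" and distr_T: "distr (dens F1) borel T = dens F0"
    using push by (auto simp: push_forward_eq_def T_def)
  have "AE v in dens F1. \<forall>w. \<psi> v + T v \<bullet> (w - v) \<le> \<psi> w"
    using AE_differentiable_of_push_forward[OF push F0s(2)]
    by eventually_elim (simp add: T_def grad_subgradient[OF convex])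
  then have opt: "W2_sq F0 F1 = 1 / 2 * (LINT v|dens F1. (norm (T v - v))\<^sup>2)"
    by (rule W2_sq_eq_subgradient_map[OF F1s(1) F0s(1) T distr_T convex_on_continuous[OF open_UNIV convex]])
  define \<omega> where "\<omega> = W2_sq F1 F0 / (real CARD('d) * \<theta>)"
  \<comment> \<open>The Euler-Lagrange equation solved for the logarithmic gradient of
    \<open>F1\<close>; the candidate for the weak gradient is therefore
    \<open>F1 v *\<^sub>R X v\<close>.\<close>
  define X where "X v = (1 / (h * \<theta>)) *\<^sub>R ((T v - u) - (h + 1 - \<omega>) *\<^sub>R (v - u))" for v
  define g where "g v = F1 v *\<^sub>R X v" for v
  define l where "l v = g v /\<^sub>R F1 v" for v

  have iT2: "integrable (dens F1) (\<lambda>v. (norm (T v))\<^sup>2)"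
    using F0s(5) unfolding distr_T[symmetric] by (simp add: integrable_distr_eq)
  have iTu2: "integrable (dens F1) (\<lambda>v. (norm (T v - u))\<^sup>2)"
    by (rule integrable_norm_diff_sq[OF _ _ iT2])
       (simp_all add: finite_measure.integrable_const prob_space.finite_measure[OF F1s(4)])
  have ivu2: "integrable (dens F1) (\<lambda>v. (norm (v - u))\<^sup>2)"
    by (rule integrable_norm_diff_sq[OF _ _ F1s(5)])
       (simp_all add: finite_measure.integrable_const prob_space.finite_measure[OF F1s(4)])
  have [measurable]: "X \<in> borel_measurable borel" unfolding X_def by measurable
  \<comment> \<open>This is already the Fisher information bound: \<open>T v - u\<close> and
    \<open>v - u\<close> are square integrable because \<open>F0\<close> and \<open>F1\<close> have
    finite second moments.\<close>
  have iX2: "integrable (dens F1) (\<lambda>v. (norm (X v))\<^sup>2)"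
    unfolding X_def norm_scaleR power_mult_distrib
    by (intro integrable_mult_right integrable_norm_diff_sq iTu2) (simp_all add: power_mult_distrib ivu2)
  have iX: "integrable (dens F1) X"
    by (rule finite_measure.integrable_of_norm_square[OF prob_space.finite_measure[OF F1s(4)] _ iX2]) simp
  have ivu: "integrable (dens F1) (\<lambda>v. v - u)"
    by (rule finite_measure.integrable_of_norm_square[OF prob_space.finite_measure[OF F1s(4)] _ ivu2]) simp
  have ig: "integrable lborel g"
    using iX F1s(3) unfolding g_def by (subst (asm) integrable_density) auto
  have iFv: "integrable lborel (\<lambda>v. F1 v *\<^sub>R (v - u))"
    using ivu F1s(3) by (subst (asm) integrable_density) auto
  have iF: "integrable lborel F1" using F1s(1) by (simp add: prob_densities_def)

  have weak: "has_weak_gradient F1 g"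
    unfolding has_weak_gradient_def
  proof (intro conjI allI impI integrable_imp_locally_integrable iF ig)
    fix \<phi> :: "real ^ 'd \<Rightarrow> real" and D
    assume "(\<forall>x. GDERIV \<phi> x :> D x) \<and> continuous_on UNIV D \<and> compact (closure {x. \<phi> x \<noteq> 0})"
    then have \<phi>: "\<And>x. GDERIV \<phi> x :> D x" and D: "continuous_on UNIV D" and supp: "compact (closure {x. \<phi> x \<noteq> 0})"
      by auto
    have \<phi>c: "continuous_on UNIV \<phi>" using \<phi> by (rule GDERIV_continuous_on)
    have [measurable]: "\<phi> \<in> borel_measurable borel" "D \<in> borel_measurable borel"
      using \<phi>c D by (auto intro: borel_measurable_continuous_onI)
    have \<phi>0: "\<phi> x = 0" if "x \<notin> closure {x. \<phi> x \<noteq> 0}" for x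
      using that closure_subset[of "{x. \<phi> x \<noteq> 0}"] by auto
    obtain B where "\<And>x. norm (\<phi> x) \<le> B"
      using compact_support_bounded[OF \<phi>c supp \<phi>0] by blast
    then have B: "\<bar>\<phi> x\<bar> \<le> B" if "x \<in> closure {x. \<phi> x \<noteq> 0}" for x by simp
    obtain BD where BD: "\<And>x. norm (D x) \<le> BD"
      using compact_support_bounded[OF D supp gradient_zero_outside_support[OF \<phi>]] by blast
    have i\<phi>g: "integrable lborel (\<lambda>x. \<phi> x *\<^sub>R g x)"
      by (rule integrable_compact_support_scaleR[OF integrable_imp_locally_integrable[OF ig] _ supp B \<phi>0]) simp_all
    have iFD: "integrable lborel (\<lambda>x. F1 x *\<^sub>R D x)"
    proof (rule Bochner_Integration.integrable_bound)
      show "integrable lborel (\<lambda>x. BD * F1 x)" using iF by simp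
      show "AE x in lborel. norm (F1 x *\<^sub>R D x) \<le> norm (BD * F1 x)"
        using BD F1s(3) by (intro AE_I2)
          (auto simp: abs_mult mult.commute intro!: mult_left_mono intro: order_trans[OF _ abs_ge_self])
    qed simp
    show "(LINT x|lborel. F1 x *\<^sub>R D x) = - (LINT x|lborel. \<phi> x *\<^sub>R g x)"
    proof (rule euclidean_eqI)
      fix e :: "real ^ 'd" assume e: "e \<in> Basis"
      have "h * \<theta> * (LINT v|dens F1. D v \<bullet> e)
          = (LINT v|dens F1. \<phi> v * (((h + 1 - \<omega>) *\<^sub>R (v - u) - (T v - u)) \<bullet> e))"
        using minimizer_euler_lagrange[OF \<theta> h F0 min T distr_T opt \<phi> D supp e] by (simp add: \<omega>_def W2_sq_commute)
      also have "\<dots> = (LINT v|dens F1. (h * \<theta>) * (- (\<phi> v * (X v \<bullet> e))))"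
        using h \<theta> by (intro Bochner_Integration.integral_cong refl) (simp add: X_def inner_diff_left algebra_simps)
      finally have "(h * \<theta>) * (LINT v|dens F1. D v \<bullet> e) = (h * \<theta>) * (- (LINT v|dens F1. \<phi> v * (X v \<bullet> e)))"
        by simp
      then have "(LINT v|dens F1. D v \<bullet> e) = - (LINT v|dens F1. \<phi> v * (X v \<bullet> e))"
        by (rule mult_left_cancel[THEN iffD1, rotated]) (use h \<theta> in simp)
      moreover have "(LINT v|dens F1. D v \<bullet> e) = (LINT x|lborel. F1 x *\<^sub>R D x) \<bullet> e"
        using F1s(3) iFD by (simp add: integral_density integral_inner_left[symmetric])
      moreover have "(LINT v|dens F1. \<phi> v * (X v \<bullet> e)) = (LINT x|lborel. \<phi> x *\<^sub>R g x) \<bullet> e"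
        using F1s(3) i\<phi>g by (simp add: integral_density integral_inner_left[symmetric] g_def ac_simps)
      ultimately show "(LINT x|lborel. F1 x *\<^sub>R D x) \<bullet> e = - (LINT x|lborel. \<phi> x *\<^sub>R g x) \<bullet> e" by simp
    qed
  qed

  define c where "c = (2 * pi * \<theta>) powr (- real CARD('d) / 2)"
  have c: "c > 0" using \<theta> by (simp add: c_def)
  \<comment> \<open>The reciprocal of the Maxwellian, a smooth function, so that the quotient
    becomes a product covered by \<open>has_weak_gradient_mult\<close>.\<close>
  define m where "m v = (1 / c) * exp ((norm (v - u))\<^sup>2 / (2 * \<theta>))" for v
  have mean: "mean F1 = u" and temp: "variance_temp F1 = \<theta>"
    using F1 by (auto simp: constraint_set_def variance_temp_def)
  have maxw: "F1 v / maxwellian F1 v = m v * F1 v" for v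
  proof -
    define x where "x = (norm (v - u))\<^sup>2 / (2 * \<theta>)"
    have "maxwellian F1 v = c * exp (- x)"
      by (simp only: maxwellian_def mean temp c_def x_def minus_divide_left)
    moreover have "m v = (1 / c) * exp x" by (simp only: m_def x_def)
    moreover have "F1 v / (c * exp (- x)) = (1 / c) * exp x * F1 v"
      using c by (simp add: exp_minus field_simps)
    ultimately show ?thesis by (simp only:)
  qed
  define Dm where "Dm v = (m v / \<theta>) *\<^sub>R (v - u)" for v
  have m: "GDERIV m x :> Dm x" for x
  proof -
    have "(m has_derivative (\<lambda>y. m x / \<theta> * (y \<bullet> (x - u)))) (at x)"
      unfolding m_def[abs_def] power2_norm_eq_inner
      using \<theta> c by (auto intro!: derivative_eq_intros simp: fun_eq_iff inner_commute field_simps)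
    then show ?thesis by (simp add: gderiv_def Dm_def)
  qed
  have mc: "continuous_on UNIV m" using m by (rule GDERIV_continuous_on)
  have Dmc: "continuous_on UNIV Dm"
    unfolding Dm_def using \<theta> by (intro continuous_intros mc) auto
  \<comment> \<open>Since \<open>m\<close> grows like an inverse Gaussian, boundedness on compact
    sets is used; this is why weak gradients are handled with local integrability.\<close>
  have "locally_integrable (\<lambda>x. (m x / \<theta>) *\<^sub>R (F1 x *\<^sub>R (x - u)))"
    using \<theta> by (intro locally_integrable_scaleR_continuous integrable_imp_locally_integrable iFv continuous_intros mc) auto
  then have fDm: "locally_integrable (\<lambda>x. F1 x *\<^sub>R Dm x)"
    by (simp add: Dm_def mult.commute)
  define k where "k v = (m v *\<^sub>R g v + F1 v *\<^sub>R Dm v) /\<^sub>R (F1 v / maxwellian F1 v)" for v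
  have "has_weak_gradient (\<lambda>v. F1 v / maxwellian F1 v) (\<lambda>v. m v *\<^sub>R g v + F1 v *\<^sub>R Dm v)"
    unfolding maxw by (rule has_weak_gradient_mult[OF weak m Dmc fDm])
  then have "has_weak_log_gradient (\<lambda>v. F1 v / maxwellian F1 v) k"
    unfolding has_weak_log_gradient_def k_def[abs_def] by blast
  moreover have "has_weak_log_gradient F1 l"
    using weak unfolding has_weak_log_gradient_def l_def[abs_def] by blast
  moreover have "(\<integral>\<^sup>+ v. ennreal ((norm (l v))\<^sup>2 * F1 v) \<partial>lborel) < \<infinity>"
  proof -
    have "(\<integral>\<^sup>+ v. ennreal ((norm (l v))\<^sup>2 * F1 v) \<partial>lborel) = (\<integral>\<^sup>+ v. ennreal ((norm (X v))\<^sup>2) \<partial>dens F1)"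
    proof (subst nn_integral_density)
      \<comment> \<open>At zeros of \<open>F1\<close> the value of \<open>l\<close> is 0 by
        convention and may differ from \<open>X\<close>, but the weight makes both sides
        vanish.\<close>
      have "(norm (l v))\<^sup>2 * F1 v = F1 v * (norm (X v))\<^sup>2" for v
        by (cases "F1 v = 0") (simp_all add: l_def g_def)
      then show "(\<integral>\<^sup>+ v. ennreal ((norm (l v))\<^sup>2 * F1 v) \<partial>lborel) = (\<integral>\<^sup>+ v. ennreal (F1 v) * ennreal ((norm (X v))\<^sup>2) \<partial>lborel)"
        using F1s(3) by (simp only: ennreal_mult zero_le_power2)
    qed auto
    also have "\<dots> < \<infinity>" using iX2 by (simp add: integrable_iff_bounded)
    finally show ?thesis .
  qed
  moreover have "AE v in dens F1. grad \<psi> v = v + (h * \<theta>) *\<^sub>R k v + (W2_sq F1 F0 / (real CARD('d) * \<theta>)) *\<^sub>R (u - v)"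
  proof -
    \<comment> \<open>Dividing by \<open>F1 v\<close> recovers the logarithmic gradient only where
      \<open>F1\<close> is positive, which is almost everywhere for \<open>dens F1\<close>.\<close>
    have "grad \<psi> v = v + (h * \<theta>) *\<^sub>R k v + \<omega> *\<^sub>R (u - v)" if "0 < F1 v" for v
    proof -
      have "m v > 0" using c by (simp add: m_def)
      have "m v *\<^sub>R g v + F1 v *\<^sub>R Dm v = (m v * F1 v) *\<^sub>R (X v + (1 / \<theta>) *\<^sub>R (v - u))"
        unfolding g_def Dm_def by (simp add: scaleR_add_right mult.commute)
      moreover have "inverse (m v * F1 v) * (m v * F1 v) = 1" using \<open>m v > 0\<close> that by (intro left_inverse) simp
      ultimately have "k v = X v + (1 / \<theta>) *\<^sub>R (v - u)"
        by (simp only: k_def maxw scaleR_scaleR scaleR_one)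
      \<comment> \<open>The Maxwellian contributes \<open>(1 / \<theta>) *\<^sub>R (v - u)\<close>
        to \<open>k\<close>, hence \<open>h *\<^sub>R (v - u)\<close> here, which cancels the
        \<open>h\<close> in the coefficient \<open>h + 1 - \<omega>\<close>.\<close>
      then have "(h * \<theta>) *\<^sub>R k v = ((T v - u) - (h + 1 - \<omega>) *\<^sub>R (v - u)) + h *\<^sub>R (v - u)"
        using h \<theta> by (simp add: X_def scaleR_add_right)
      then show ?thesis unfolding T_def[symmetric] by (simp add: algebra_simps)
    qed
    then show ?thesis unfolding \<omega>_def[symmetric] by (subst AE_density) auto
  qed
  ultimately show ?thesis by blast
qed

end
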